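(* For each $n\ge3$, there are smooth monotone functions $U_N$ ($N\in\mathbb N$) and a Lipschitz monotone function $U$ on $\Omega=(-2,2)^n$, with $U_N\to U$ uniformly and strongly in $W^{1,p}(\Omega)$ for every $1\le p<\infty$, such that for almost every $t\in(-1,1)$ all of the sets $U_N^{-1}(t)\cap\Omega$ are smooth embedded hypersurfaces whereas $U^{-1}(t)\cap\Omega$ is not a topological manifold. After taking a subsequence, the superlevel characteristic functions $\chi_{\{U_N>t\}}$ also converge strictly in $BV(\Omega)$ to $\chi_{\{U>t\}}$ for almost every such $t$.
   Context: A continuous function $f:\Omega\to\mathbb R$ on an open set $\Omega\subset\mathbb R^n$ is monotone (in the sense of Lebesgue) if $\max_{\overline V}f=\max_{\partial V}f$ and $\min_{\overline V}f=\min_{\partial V}f$ for every nonempty open $V$ with $\overline V$ compact and contained in $\Omega$. Strict convergence in $BV(\Omega)$ means convergence in $L^1(\Omega)$ together with convergence of the total variations of the distributional gradients in $\Omega$. *)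

theory Defs
  imports "HOL-Analysis.Analysis"
begin

section \<open>Monotone functions in the sense of Lebesgue\<close>

text \<open>The suprema and infima below are maxima and minima: \<open>f\<close> is continuous, \<open>closure V\<close> is
  compact and nonempty, and so is \<open>frontier V\<close>, since a nonempty bounded open set is not closed.\<close>

definition lebesgue_monotone :: "'a::euclidean_space set \<Rightarrow> ('a \<Rightarrow> real) \<Rightarrow> bool" where
  "lebesgue_monotone \<Omega> f \<longleftrightarrow> continuous_on \<Omega> f \<and>
     (\<forall>V. open V \<and> V \<noteq> {} \<and> compact (closure V) \<and> closure V \<subseteq> \<Omega> \<longrightarrow>
        Sup (f ` closure V) = Sup (f ` frontier V) \<and>
        Inf (f ` closure V) = Inf (f ` frontier V))"

section \<open>Smooth functions and smooth hypersurfaces\<close>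

text \<open>\<open>Ck_on k S f\<close> is meant for open \<open>S\<close>. As the domain is finite-dimensional, continuity of all
  directional derivatives is the same as continuity of the Frechet derivative.\<close>

primrec Ck_on :: "nat \<Rightarrow> 'a::euclidean_space set \<Rightarrow> ('a \<Rightarrow> 'b::euclidean_space) \<Rightarrow> bool" where
  "Ck_on 0 S f \<longleftrightarrow> continuous_on S f"
| "Ck_on (Suc k) S f \<longleftrightarrow> (\<forall>x\<in>S. f differentiable at x) \<and>
     (\<forall>v. Ck_on k S (\<lambda>x. frechet_derivative f (at x) v))"

definition smooth_on :: "'a::euclidean_space set \<Rightarrow> ('a \<Rightarrow> 'b::euclidean_space) \<Rightarrow> bool" where
  "smooth_on S f \<longleftrightarrow> (\<forall>k. Ck_on k S f)"

definition smooth_diffeomorphism ::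
  "'a::euclidean_space set \<Rightarrow> 'a set \<Rightarrow> ('a \<Rightarrow> 'a) \<Rightarrow> ('a \<Rightarrow> 'a) \<Rightarrow> bool" where
  "smooth_diffeomorphism W W' \<Phi> \<Psi> \<longleftrightarrow>
     open W \<and> open W' \<and> homeomorphism W W' \<Phi> \<Psi> \<and> smooth_on W \<Phi> \<and> smooth_on W' \<Psi>"

text \<open>Slice charts: near each of its points \<open>S\<close> is flattened to a coordinate hyperplane by a
  diffeomorphism of the ambient space. The empty set is a hypersurface, as usual.\<close>

definition smooth_embedded_hypersurface :: "(real ^ 'n::finite) set \<Rightarrow> bool" where
  "smooth_embedded_hypersurface S \<longleftrightarrow>
     (\<forall>x\<in>S. \<exists>W W' \<Phi> \<Psi> k. x \<in> W \<and> smooth_diffeomorphism W W' \<Phi> \<Psi> \<and>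
        \<Phi> ` (S \<inter> W) = {y \<in> W'. y $ k = 0})"

section \<open>Topological manifolds\<close>

definition topological_manifold_dim :: "nat \<Rightarrow> 'a topology \<Rightarrow> bool" where
  "topological_manifold_dim d X \<longleftrightarrow> Hausdorff_space X \<and> second_countable X \<and>
     (\<forall>x \<in> topspace X. \<exists>W V. openin X W \<and> x \<in> W \<and> openin (Euclidean_space d) V \<and>
        subtopology X W homeomorphic_space subtopology (Euclidean_space d) V)"

definition topological_manifold :: "'a topology \<Rightarrow> bool" where
  "topological_manifold X \<longleftrightarrow> (\<exists>d. topological_manifold_dim d X)"

section \<open>Sobolev convergence\<close>

definition test_function ::
  "'a::euclidean_space set \<Rightarrow> ('a \<Rightarrow> 'b::euclidean_space) \<Rightarrow> bool" where
  "test_function \<Omega> \<phi> \<longleftrightarrow> smooth_on UNIV \<phi> \<and>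
     compact (closure {x. \<phi> x \<noteq> 0}) \<and> closure {x. \<phi> x \<noteq> 0} \<subseteq> \<Omega>"

definition partial_deriv ::
  "'n::finite \<Rightarrow> (real ^ 'n \<Rightarrow> 'b::euclidean_space) \<Rightarrow> real ^ 'n \<Rightarrow> 'b" where
  "partial_deriv i f x = frechet_derivative f (at x) (axis i 1)"

definition locally_integrable_on ::
  "('a::euclidean_space \<Rightarrow> 'b::euclidean_space) \<Rightarrow> 'a set \<Rightarrow> bool" where
  "locally_integrable_on f \<Omega> \<longleftrightarrow> (\<forall>K. compact K \<and> K \<subseteq> \<Omega> \<longrightarrow> set_integrable lebesgue K f)"

definition weak_gradient ::
  "(real ^ 'n::finite) set \<Rightarrow> (real ^ 'n \<Rightarrow> real) \<Rightarrow> (real ^ 'n \<Rightarrow> real ^ 'n) \<Rightarrow> bool" where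
  "weak_gradient \<Omega> f G \<longleftrightarrow> locally_integrable_on f \<Omega> \<and> locally_integrable_on G \<Omega> \<and>
     (\<forall>\<phi> :: real ^ 'n \<Rightarrow> real. test_function \<Omega> \<phi> \<longrightarrow>
        (\<forall>i. (LINT x:\<Omega>|lebesgue. f x * partial_deriv i \<phi> x) =
             - (LINT x:\<Omega>|lebesgue. G x $ i * \<phi> x)))"

definition in_Lp ::
  "real \<Rightarrow> 'a::euclidean_space set \<Rightarrow> ('a \<Rightarrow> 'b::euclidean_space) \<Rightarrow> bool" where
  "in_Lp p \<Omega> f \<longleftrightarrow> set_borel_measurable lebesgue \<Omega> f \<and>
     set_integrable lebesgue \<Omega> (\<lambda>x. norm (f x) powr p)"

definition Lp_norm ::
  "real \<Rightarrow> 'a::euclidean_space set \<Rightarrow> ('a \<Rightarrow> 'b::euclidean_space) \<Rightarrow> real" where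
  "Lp_norm p \<Omega> f = (LINT x:\<Omega>|lebesgue. norm (f x) powr p) powr (1 / p)"

text \<open>Weak gradients are unique up to null sets, so it does not matter which ones are chosen.\<close>

definition W1p_tendsto ::
  "real \<Rightarrow> (real ^ 'n::finite) set \<Rightarrow> (nat \<Rightarrow> real ^ 'n \<Rightarrow> real) \<Rightarrow> (real ^ 'n \<Rightarrow> real) \<Rightarrow> bool" where
  "W1p_tendsto p \<Omega> u f \<longleftrightarrow> (\<exists>Du Df.
     (\<forall>N. in_Lp p \<Omega> (u N) \<and> weak_gradient \<Omega> (u N) (Du N) \<and> in_Lp p \<Omega> (Du N)) \<and>
     in_Lp p \<Omega> f \<and> weak_gradient \<Omega> f Df \<and> in_Lp p \<Omega> Df \<and>
     (\<lambda>N. Lp_norm p \<Omega> (\<lambda>x. u N x - f x)) \<longlonglongrightarrow> 0 \<and>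
     (\<lambda>N. Lp_norm p \<Omega> (\<lambda>x. Du N x - Df x)) \<longlonglongrightarrow> 0)"

section \<open>Strict convergence in BV\<close>

definition divergence :: "(real ^ 'n::finite \<Rightarrow> real ^ 'n) \<Rightarrow> real ^ 'n \<Rightarrow> real" where
  "divergence \<phi> x = (\<Sum>i\<in>UNIV. partial_deriv i \<phi> x $ i)"

text \<open>The distributional gradient of \<open>f\<close>, as a linear functional on test vector fields.\<close>

definition distributional_gradient ::
  "(real ^ 'n::finite) set \<Rightarrow> (real ^ 'n \<Rightarrow> real) \<Rightarrow> (real ^ 'n \<Rightarrow> real ^ 'n) \<Rightarrow> real" where
  "distributional_gradient \<Omega> f \<phi> = - (LINT x:\<Omega>|lebesgue. f x * divergence \<phi> x)"

definition total_variation ::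
  "(real ^ 'n::finite) set \<Rightarrow> (real ^ 'n \<Rightarrow> real) \<Rightarrow> ereal" where
  "total_variation \<Omega> f =
     (SUP \<phi> \<in> {\<phi>. test_function \<Omega> \<phi> \<and> (\<forall>x. norm (\<phi> x) \<le> 1)}.
        ereal (distributional_gradient \<Omega> f \<phi>))"

definition in_BV :: "(real ^ 'n::finite) set \<Rightarrow> (real ^ 'n \<Rightarrow> real) \<Rightarrow> bool" where
  "in_BV \<Omega> f \<longleftrightarrow> in_Lp 1 \<Omega> f \<and> total_variation \<Omega> f < \<infinity>"

definition strict_BV_tendsto ::
  "(real ^ 'n::finite) set \<Rightarrow> (nat \<Rightarrow> real ^ 'n \<Rightarrow> real) \<Rightarrow> (real ^ 'n \<Rightarrow> real) \<Rightarrow> bool" where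
  "strict_BV_tendsto \<Omega> u f \<longleftrightarrow> (\<forall>N. in_BV \<Omega> (u N)) \<and> in_BV \<Omega> f \<and>
     (\<lambda>N. Lp_norm 1 \<Omega> (\<lambda>x. u N x - f x)) \<longlonglongrightarrow> 0 \<and>
     (\<lambda>N. total_variation \<Omega> (u N)) \<longlonglongrightarrow> total_variation \<Omega> f"

end

theory Submission
  imports Defs
begin

text \<open>A function that does not depend on one of the coordinates is monotone, because every point of
  \<open>V\<close> can be moved to \<open>frontier V\<close> along that coordinate without changing the value. As \<open>n \<ge> 3\<close>, this
  leaves two coordinates \<open>y\<close>, \<open>z\<close> with complete freedom. Let \<open>U\<close> be \<open>z\<close> plus a sum of ripples, the
  \<open>k\<close>-th of which is supported in the strip \<open>2^-(k+1) < y < 2^-k\<close> and makes closed level curves at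
  every height; these accumulate at \<open>y = 0\<close>, so no level set of \<open>U\<close> is locally connected there. The
  partial sums \<open>U\<^sub>N\<close> are smooth with countably many critical values, and differ from \<open>U\<close> only in
  \<open>0 < y < 2^-N\<close>, where all gradients are bounded by the same constant. A coarea inequality bounds the
  \<open>t\<close>-integral of the difference of the perimeters of \<open>{U\<^sub>N > t}\<close> and \<open>{U > t}\<close> by a multiple of \<open>2^-N\<close>,
  which is summable, so that strict convergence holds for almost every \<open>t\<close> without a subsequence.\<close>

section \<open>Calculus of smooth functions\<close>

text \<open>On the hyperplane where the ripples accumulate \<open>U\<close> has gradient
  \<open>axis b 1\<close>, so if \<open>U\<close> were C^1 the implicit function theorem would make
  its level sets smooth there. Hence the gradients must not settle down: amplitude and wavelength of
  the \<open>k\<close>-th ripple are both of order 4^-k, so its slope along \<open>z\<close> is of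
  order one at every scale, while its slope along \<open>y\<close> decays like 2^-k. The limit is
  differentiable at every point with a bounded but discontinuous gradient, and the gradients
  converge in L^p because the sets where they differ shrink, not because they become uniformly
  close. For this reason the integration by parts is set up for pointwise derivatives that are
  merely bounded and Borel. The manifold property is refuted through local connectedness, which
  excludes all dimensions at once and needs no comparison of Euclidean spaces of different
  dimension.\<close>

lemma Ck_on_cong:
  assumes "open S" "\<And>x. x \<in> S \<Longrightarrow> f x = g x" "Ck_on k S f"
  shows "Ck_on k S g"
  using assms(2,3)
proof (induction k arbitrary: f g)
  case 0
  then show ?case by (auto cong: continuous_on_cong)
next
  case (Suc k)
  have "(g has_derivative frechet_derivative f (at x)) (at x)" if "x \<in> S" for x
  proof (rule has_derivative_transform_within_open[OF _ assms(1) that])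
    show "(f has_derivative frechet_derivative f (at x)) (at x)"
      using Suc.prems that by (simp add: frechet_derivative_works)
  qed (use Suc.prems(1) in auto)
  note d = this
  have e: "frechet_derivative f (at x) = frechet_derivative g (at x)" if "x \<in> S" for x
    by (rule frechet_derivative_at[OF d[OF that]])
  have "Ck_on k S (\<lambda>x. frechet_derivative g (at x) v)" for v
    by (rule Suc.IH[of "\<lambda>x. frechet_derivative f (at x) v"]) (use Suc.prems(2) e in auto)
  then show ?case
    using d by (auto simp: differentiable_def)
qed

text \<open>Derivatives are unique, so an explicit formula \<open>D\<close> may replace the one
  picked by \<open>frechet_derivative\<close>; \<open>Ck_on_cong\<close> transports the lower
  orders. Most closure properties below go through this rule.\<close>

lemma Ck_on_SucI:
  assumes "open S" "\<And>x. x \<in> S \<Longrightarrow> (f has_derivative D x) (at x)"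
    "\<And>v. Ck_on k S (\<lambda>x. D x v)"
  shows "Ck_on (Suc k) S f"
proof -
  have "Ck_on k S (\<lambda>x. frechet_derivative f (at x) v)" for v
    by (rule Ck_on_cong[OF assms(1) _ assms(3)]) (use frechet_derivative_at[OF assms(2)] in auto)
  then show ?thesis
    using assms(2) by (auto simp: differentiable_def)
qed

lemma Ck_on_SucD:
  assumes "Ck_on (Suc k) S f"
  shows "\<And>x. x \<in> S \<Longrightarrow> (f has_derivative frechet_derivative f (at x)) (at x)"
    "Ck_on k S (\<lambda>x. frechet_derivative f (at x) v)"
  using assms by (auto simp: frechet_derivative_works)

lemma Ck_on_Suc_imp: "Ck_on (Suc k) S f \<Longrightarrow> Ck_on k S f"
proof (induction k arbitrary: f)
  case 0
  then show ?case
    by (meson Ck_on.simps differentiable_at_withinI differentiable_imp_continuous_on differentiable_on_def)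
next
  case (Suc k)
  then show ?case by (metis Ck_on.simps(2))
qed

lemma Ck_on_subset: "Ck_on k S f \<Longrightarrow> T \<subseteq> S \<Longrightarrow> Ck_on k T f"
  by (induction k arbitrary: f) (auto intro: continuous_on_subset)

lemma Ck_on_const: 
  assumes "open S"
  shows "Ck_on k S (\<lambda>x. c)"
proof (induction k arbitrary: c)
  case (Suc k)
  show ?case
    by (rule Ck_on_SucI[OF assms has_derivative_const Suc])
qed auto

lemma Ck_on_linear:
  assumes "open S" "bounded_linear f"
  shows "Ck_on k S f"
proof (cases k)
  case (Suc m)
  show ?thesis
    unfolding Suc
    by (rule Ck_on_SucI[OF assms(1) bounded_linear_imp_has_derivative[OF assms(2)] Ck_on_const[OF assms(1)]])
qed (use assms in \<open>auto intro: linear_continuous_on\<close>)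

lemma Ck_on_compose_linear:
  assumes "open S" "bounded_linear L" "Ck_on k S f"
  shows "Ck_on k S (\<lambda>x. L (f x))"
  using assms(3)
proof (induction k arbitrary: f)
  case 0
  then show ?case by (auto intro: bounded_linear.continuous_on[OF assms(2)])
next
  case (Suc k)
  show ?case
    by (rule Ck_on_SucI[OF assms(1) bounded_linear.has_derivative[OF assms(2) Ck_on_SucD(1)[OF Suc.prems]]
          Suc.IH[OF Ck_on_SucD(2)[OF Suc.prems]]])
qed

lemma Ck_on_add:
  assumes "open S" "Ck_on k S f" "Ck_on k S g"
  shows "Ck_on k S (\<lambda>x. f x + g x)"
  using assms(2,3)
proof (induction k arbitrary: f g)
  case 0
  then show ?case by (auto intro: continuous_on_add)
next
  case (Suc k)
  note D = Ck_on_SucD[OF Suc.prems(1)] Ck_on_SucD[OF Suc.prems(2)]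
  show ?case
    by (rule Ck_on_SucI[OF assms(1) has_derivative_add[OF D(1,3)] Suc.IH[OF D(2,4)]])
qed

lemma Ck_on_sum:
  assumes "open S" "\<And>i. i \<in> I \<Longrightarrow> Ck_on k S (f i)"
  shows "Ck_on k S (\<lambda>x. \<Sum>i\<in>I. f i x)"
  using assms(2) by (induction I rule: infinite_finite_induct)
   (auto intro: Ck_on_const Ck_on_add assms(1))

lemma Ck_on_scaleR:
  assumes "open S" "Ck_on k S f" "Ck_on k S g"
  shows "Ck_on k S (\<lambda>x. f x *\<^sub>R g x)"
  using assms(2,3)
proof (induction k arbitrary: f g)
  case 0
  then show ?case by (auto intro: continuous_on_scaleR)
next
  case (Suc k)
  note D = Ck_on_SucD[OF Suc.prems(1)] Ck_on_SucD[OF Suc.prems(2)]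
  note I = Suc.prems[THEN Ck_on_Suc_imp]
  show ?case
    by (rule Ck_on_SucI[OF assms(1) has_derivative_scaleR[OF D(1,3)]])
      (auto intro!: Ck_on_add[OF assms(1) Suc.IH[OF I(1) D(4)] Suc.IH[OF D(2) I(2)]])
qed

lemma Ck_on_mult:
  fixes f g :: "'a::euclidean_space \<Rightarrow> real"
  assumes "open S" "Ck_on k S f" "Ck_on k S g"
  shows "Ck_on k S (\<lambda>x. f x * g x)"
  using Ck_on_scaleR[OF assms] by simp

lemma Ck_on_compose:
  fixes f :: "'b::euclidean_space \<Rightarrow> 'c::euclidean_space" and g :: "'a::euclidean_space \<Rightarrow> 'b"
  assumes "open S" "g ` S \<subseteq> T" "Ck_on k T f" "Ck_on k S g"
  shows "Ck_on k S (\<lambda>x. f (g x))"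
  using assms(3,4)
proof (induction k arbitrary: f)
  case 0
  then show ?case using assms(2) by (auto intro: continuous_on_compose2)
next
  case (Suc k)
  let ?f' = "\<lambda>y. frechet_derivative f (at y)" and ?g' = "\<lambda>x. frechet_derivative g (at x)"
  show ?case
  proof (rule Ck_on_SucI[OF assms(1)])
    fix x assume x: "x \<in> S"
    have f': "(f has_derivative ?f' (g x)) (at (g x))"
      using x assms(2) Suc.prems(1) by (intro Ck_on_SucD(1)) auto
    have "((\<lambda>x. f (g x)) has_derivative (\<lambda>v. ?f' (g x) (?g' x v))) (at x)"
      using diff_chain_at[OF Ck_on_SucD(1)[OF Suc.prems(2) x] f'] by (simp add: o_def)
    \<comment> \<open>The direction \<open>?g' x v\<close> varies with \<open>x\<close>, whereas
      \<open>Ck_on\<close> speaks of derivatives in fixed directions. Expanding along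
      \<open>Basis\<close> leaves finitely many fixed directions with \<open>x\<close>-dependent
      coefficients.\<close>
    moreover have "?f' (g x) (?g' x v) = (\<Sum>b\<in>Basis. (?g' x v \<bullet> b) *\<^sub>R ?f' (g x) b)" for v
    proof -
      interpret linear "?f' (g x)" using f' by (rule has_derivative_linear)
      have "?f' (g x) (?g' x v) = ?f' (g x) (\<Sum>b\<in>Basis. (?g' x v \<bullet> b) *\<^sub>R b)"
        by (simp only: euclidean_representation)
      then show ?thesis by (simp add: sum scale)
    qed
    ultimately show "((\<lambda>x. f (g x)) has_derivative
        (\<lambda>v. \<Sum>b\<in>Basis. (?g' x v \<bullet> b) *\<^sub>R ?f' (g x) b)) (at x)"
      by (simp only:)
  next
    fix v
    have "Ck_on k S (\<lambda>x. ?f' (g x) b)" for b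
      by (rule Suc.IH[OF _ Ck_on_Suc_imp[OF Suc.prems(2)]]) (use Suc.prems(1) in auto)
    moreover have "Ck_on k S (\<lambda>x. ?g' x v \<bullet> b)" for b
      by (rule Ck_on_compose_linear[OF assms(1) bounded_linear_inner_left]) (use Suc.prems(2) in auto)
    ultimately show "Ck_on k S (\<lambda>x. \<Sum>b\<in>Basis. (?g' x v \<bullet> b) *\<^sub>R ?f' (g x) b)"
      by (intro Ck_on_sum Ck_on_scaleR assms(1))
  qed
qed

lemma Ck_on_inverse: "Ck_on k (- {0}) (inverse :: real \<Rightarrow> real)"
proof (induction k)
  case 0
  then show ?case by (auto intro!: continuous_intros)
next
  case (Suc k)
  show ?case
  proof (rule Ck_on_SucI)
    show "(inverse has_derivative (\<lambda>v. (- v) *\<^sub>R (inverse x * inverse x))) (at x)" if "x \<in> - {0}" for x :: real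
      using that by (auto intro!: derivative_eq_intros)
    show "Ck_on k (- {0}) (\<lambda>x::real. (- v) *\<^sub>R (inverse x * inverse x))" for v :: real
      by (rule Ck_on_compose_linear[OF _ bounded_linear_scaleR_right Ck_on_mult[OF _ Suc Suc]]) auto
  qed auto
qed

lemma smooth_on_sin: "smooth_on UNIV (sin :: real \<Rightarrow> real)"
proof -
  have "Ck_on k UNIV (sin :: real \<Rightarrow> real) \<and> Ck_on k UNIV (cos :: real \<Rightarrow> real)" for k
  proof (induction k)
    case 0
    then show ?case by (auto intro!: continuous_intros)
  next
    case (Suc k)
    have "Ck_on (Suc k) UNIV (sin :: real \<Rightarrow> real)"
      by (rule Ck_on_SucI[where D = "\<lambda>x v. v *\<^sub>R cos x"])
        (use Suc in \<open>auto intro!: derivative_eq_intros Ck_on_compose_linear[OF _ bounded_linear_mult_right]\<close>)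
    moreover have "Ck_on (Suc k) UNIV (cos :: real \<Rightarrow> real)"
      by (rule Ck_on_SucI[where D = "\<lambda>x v. (- v) *\<^sub>R sin x"])
        (use Suc in \<open>auto intro!: derivative_eq_intros Ck_on_compose_linear[OF _ bounded_linear_mult_right]
           Ck_on_compose_linear[OF _ bounded_linear_minus[OF bounded_linear_mult_right]]\<close>)
    ultimately show ?case by simp
  qed
  then show ?thesis by (simp add: smooth_on_def)
qed

section \<open>Smooth level sets\<close>

text \<open>The polynomial parameter makes the family closed under differentiation, so smoothness
  follows by induction over the order with \<open>p\<close> arbitrary. \<open>p = 1\<close> is the
  classical flat function exp(-1/x), the building block of \<open>bump\<close>.\<close>

definition flat_exp :: "real poly \<Rightarrow> real \<Rightarrow> real" where
  "flat_exp p x = (if x > 0 then poly p (inverse x) * exp (- inverse x) else 0)"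

lemma tendsto_poly_times_exp_minus: "((\<lambda>y. poly p y * exp (- y)) \<longlongrightarrow> (0::real)) at_top"
proof -
  have "((\<lambda>y. \<Sum>i\<le>degree p. coeff p i * (y ^ i / exp y)) \<longlongrightarrow> (\<Sum>i\<le>degree p. coeff p i * 0)) at_top"
    by (intro tendsto_intros tendsto_power_div_exp_0)
  then show ?thesis
    by (simp add: poly_altdef exp_minus sum_distrib_right divide_inverse mult.assoc)
qed

lemma flat_exp_tendsto_0: "(flat_exp p \<longlongrightarrow> 0) (at 0)"
  unfolding filterlim_at_split
proof
  show "(flat_exp p \<longlongrightarrow> 0) (at_left 0)"
    by (rule tendsto_eventually) (auto simp: eventually_at_filter flat_exp_def)
  have "eventually (\<lambda>y. poly p y * exp (- y) = flat_exp p (inverse y)) at_top"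
    using eventually_gt_at_top[of 0] by eventually_elim (simp add: flat_exp_def)
  then have "((\<lambda>y. flat_exp p (inverse y)) \<longlongrightarrow> 0) at_top"
    using tendsto_poly_times_exp_minus[of p] by (simp cong: tendsto_cong)
  then show "(flat_exp p \<longlongrightarrow> 0) (at_right 0)"
    by (simp add: filterlim_at_right_to_top)
qed

lemma flat_exp_has_derivative:
  "(flat_exp p has_real_derivative flat_exp (monom 1 2 * (p - pderiv p)) x) (at x)"
proof -
  consider "x > 0" | "x < 0" | "x = 0" by linarith
  then show ?thesis
  proof cases
    case 1
    have "((\<lambda>x. poly p (inverse x) * exp (- inverse x)) has_real_derivative
        flat_exp (monom 1 2 * (p - pderiv p)) x) (at x)"
      using 1
      by (auto intro!: derivative_eq_intros poly_DERIV[THEN DERIV_chain2]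
          simp: flat_exp_def poly_monom algebra_simps power2_eq_square)
    then show ?thesis
      by (rule has_field_derivative_transform_within_open[where S = "{0<..}"])
        (use 1 in \<open>auto simp: flat_exp_def\<close>)
  next
    case 2
    have "((\<lambda>x. 0) has_real_derivative flat_exp (monom 1 2 * (p - pderiv p)) x) (at x)"
      using 2 by (simp add: flat_exp_def)
    then show ?thesis
      by (rule has_field_derivative_transform_within_open[where S = "{..<0}"])
        (use 2 in \<open>auto simp: flat_exp_def\<close>)
  next
    case 3
    \<comment> \<open>The difference quotient at 0 is again a member of the family, so the limit
      already established applies to it.\<close>
    have "flat_exp p h / h = flat_exp (monom 1 1 * p) h" if "h \<noteq> 0" for h
      by (simp add: flat_exp_def poly_monom divide_inverse mult_ac)
    then have "((\<lambda>h. flat_exp p h / h) \<longlongrightarrow> 0) (at 0)"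
      using flat_exp_tendsto_0[of "monom 1 1 * p"]
      by (subst tendsto_cong[of _ "flat_exp (monom 1 1 * p)"]) (auto simp: eventually_at_filter)
    then show ?thesis
      by (simp add: 3 DERIV_def) (simp add: flat_exp_def)
  qed
qed

lemma smooth_on_flat_exp: "smooth_on UNIV (flat_exp p)"
proof -
  have "Ck_on k UNIV (flat_exp p)" for k
  proof (induction k arbitrary: p)
    case 0
    then show ?case
      using flat_exp_has_derivative by (auto intro: DERIV_continuous_on)
  next
    case (Suc k)
    show ?case
      by (rule Ck_on_SucI[OF _ flat_exp_has_derivative[unfolded has_field_derivative_def]])
        (auto intro!: Ck_on_compose_linear[OF _ bounded_linear_mult_left Suc])
  qed
  then show ?thesis by (simp add: smooth_on_def)
qed

text \<open>The Jacobian of \<open>x \<mapsto> x + (f x - t - x $ k) *\<^sub>R axis k 1\<close> has the explicit inverse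
  \<open>w \<mapsto> w + ((w $ k - Df w) / Df (axis k 1)) *\<^sub>R axis k 1\<close>; smoothness of the inverse chart is
  bootstrapped from this formula.\<close>

lemma level_set_slice_chart:
  fixes f :: "real ^ 'n::finite \<Rightarrow> real"
  assumes S: "open S" "smooth_on S f" "x0 \<in> S"
    and k: "frechet_derivative f (at x0) (axis k 1) \<noteq> 0"
  obtains W W' \<Phi> \<Psi> where "x0 \<in> W" "W \<subseteq> S" "smooth_diffeomorphism W W' \<Phi> \<Psi>"
    "\<And>x. \<Phi> x $ k = f x - t"
proof -
  let ?D = "\<lambda>x. frechet_derivative f (at x)" and ?e = "axis k (1::real)"
  \<comment> \<open>\<open>\<Phi>\<close> replaces the \<open>k\<close>-th coordinate of
    \<open>x\<close> by \<open>f x - t\<close>; \<open>A\<close> is its derivative and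
    \<open>B\<close> the candidate for the inverse of \<open>A\<close>.\<close>
  define \<Phi> where "\<Phi> x = x + (f x - t - x $ k) *\<^sub>R ?e" for x
  define A where "A x v = v + (?D x v - v $ k) *\<^sub>R ?e" for x v
  define B where "B x w = w + ((w $ k - ?D x w) * inverse (?D x ?e)) *\<^sub>R ?e" for x w
  have Ck: "Ck_on m S f" for m using S(2) by (simp add: smooth_on_def)
  have CkD: "Ck_on m S (\<lambda>x. ?D x v)" for m v by (rule Ck_on_SucD(2)[OF Ck])
  have f': "(f has_derivative ?D x) (at x)" if "x \<in> S" for x
    using Ck_on_SucD(1)[OF Ck that] .
  have lin: "linear (?D x)" if "x \<in> S" for x using f'[OF that] by (rule has_derivative_linear)
  have \<Phi>': "(\<Phi> has_derivative A x) (at x)" if "x \<in> S" for x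
    unfolding \<Phi>_def A_def using f'[OF that]
    by (auto intro!: derivative_eq_intros bounded_linear_imp_has_derivative)
  have AB: "A x (B x w) = w" if "x \<in> S" "?D x ?e \<noteq> 0" for x w
  proof -
    define c where "c = (w $ k - ?D x w) * inverse (?D x ?e)"
    have "?D x (B x w) = ?D x w + c * ?D x ?e"
      using that(1) by (simp add: B_def c_def linear_add[OF lin] linear_cmul[OF lin])
    also have "\<dots> = w $ k" using that(2) by (simp add: c_def mult.assoc)
    finally show ?thesis by (simp add: A_def) (simp add: B_def c_def)
  qed
  have BA: "B x (A x v) = v" if "x \<in> S" "?D x ?e \<noteq> 0" for x v
  proof -
    have "?D x (A x v) = ?D x v + (?D x v - v $ k) * ?D x ?e"
      using that(1) by (simp add: A_def linear_add[OF lin] linear_cmul[OF lin])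
    then have "((A x v) $ k - ?D x (A x v)) * inverse (?D x ?e) = v $ k - ?D x v"
      using that(2) by (simp add: A_def field_simps)
    then show ?thesis by (simp add: B_def) (simp add: A_def flip: scaleR_add_left)
  qed
  have bA: "bounded_linear (A x)" if "x \<in> S" for x
    using \<Phi>'[OF that] by (rule has_derivative_bounded_linear)
  have bB: "bounded_linear (B x)" if "x \<in> S" for x
    unfolding B_def using has_derivative_bounded_linear[OF f'[OF that]]
    by (intro bounded_linear_add bounded_linear_ident bounded_linear_scaleR_left[THEN bounded_linear_compose]
       bounded_linear_mult_left[THEN bounded_linear_compose] bounded_linear_sub bounded_linear_vec_nth)
  have inv: "Blinfun (B x0) o\<^sub>L Blinfun (A x0) = id_blinfun"
    by (rule blinfun_eqI)
      (simp add: bounded_linear_Blinfun_apply bA bB S(3) BA[OF S(3) k])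
  have cont: "continuous_on S (\<lambda>x. Blinfun (A x))"
  proof (rule continuous_on_blinfun_componentwise)
    fix i :: "real ^ 'n"
    have "continuous_on S (\<lambda>x. A x i)"
      unfolding A_def using CkD[of 0] by (auto intro!: continuous_intros)
    then show "continuous_on S (\<lambda>x. blinfun_apply (Blinfun (A x)) i)"
      by (rule continuous_on_eq) (simp add: bounded_linear_Blinfun_apply bA)
  qed
  obtain U' V g g' where U': "open U'" "U' \<subseteq> S" "x0 \<in> U'" "open V" "homeomorphism U' V \<Phi> g"
    and g: "\<And>y. y \<in> V \<Longrightarrow> (g has_derivative g' y) (at y)"
      "\<And>y. y \<in> V \<Longrightarrow> g' y = inv (blinfun_apply (Blinfun (A (g y))))"
      "\<And>y. y \<in> V \<Longrightarrow> bij (blinfun_apply (Blinfun (A (g y))))"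
    using inverse_function_theorem[OF S(1) _ cont S(3) inv] \<Phi>'
    by (metis bA bounded_linear_Blinfun_apply)
  have gS: "g y \<in> S" if "y \<in> V" for y
    using U'(2,5) that unfolding homeomorphism_def by blast
  \<comment> \<open>\<open>A x\<close> maps \<open>?e\<close> to a multiple of itself with factor
    \<open>?D x ?e\<close>, so invertibility of the Jacobian on all of \<open>V\<close> keeps the
    denominator in \<open>B\<close> nonzero.\<close>
  have ne: "?D (g y) ?e \<noteq> 0" if "y \<in> V" for y
  proof
    assume "?D (g y) ?e = 0"
    then have "A (g y) ?e = A (g y) 0"
      using linear_0[OF lin[OF gS[OF that]]] by (auto simp: A_def)
    moreover have "inj (A (g y))"
      using g(3)[OF that] bA[OF gS[OF that]] by (simp add: bij_is_inj bounded_linear_Blinfun_apply)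
    ultimately have "?e = 0" by (metis injD)
    then show False by simp
  qed
  have g': "g' y = B (g y)" if "y \<in> V" for y
  proof
    fix w
    have "inj (A (g y))"
      using g(3)[OF that] bA[OF gS[OF that]] by (simp add: bij_is_inj bounded_linear_Blinfun_apply)
    then show "g' y w = B (g y) w"
      unfolding g(2)[OF that] bounded_linear_Blinfun_apply[OF bA[OF gS[OF that]]]
      using AB[OF gS[OF that] ne[OF that]] by (intro inv_f_eq)
  qed
  have "Ck_on m V g" for m
  proof (induction m)
    case 0
    show ?case using U'(5) by (simp add: homeomorphism_def)
  next
    case (Suc m)
    have D: "Ck_on m V (\<lambda>y. ?D (g y) w)" for w
      by (rule Ck_on_compose[OF U'(4) _ CkD Suc]) (use gS in auto)
    have I: "Ck_on m V (\<lambda>y. inverse (?D (g y) ?e))"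
      by (rule Ck_on_compose[OF U'(4) _ Ck_on_inverse D]) (use ne in auto)
    have "Ck_on m V (\<lambda>y. w $ k + (- 1) * ?D (g y) w)" for w
      by (intro Ck_on_add Ck_on_mult Ck_on_const D U')
    then have "Ck_on m V (\<lambda>y. w $ k - ?D (g y) w)" for w by simp
    then have BC: "Ck_on m V (\<lambda>y. B (g y) w)" for w
      unfolding B_def by (intro Ck_on_add Ck_on_scaleR Ck_on_mult Ck_on_const I Suc U')
    show ?case
      by (rule Ck_on_SucI[OF U'(4) _ BC]) (use g(1) g' in auto)
  qed
  moreover have "Ck_on m U' \<Phi>" for m
  proof -
    have "Ck_on m S (\<lambda>x. x + (f x + (- t + (- x $ k))) *\<^sub>R ?e)"
      by (intro Ck_on_add Ck_on_scaleR Ck_on_const Ck S Ck_on_linear bounded_linear_ident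
         bounded_linear_minus bounded_linear_vec_nth)
    then show ?thesis
      by (intro Ck_on_subset[OF _ U'(2)]) (simp add: \<Phi>_def[abs_def] algebra_simps)
  qed
  ultimately have "smooth_diffeomorphism U' V \<Phi> g"
    using U' by (simp add: smooth_diffeomorphism_def smooth_on_def)
  then show thesis
    using U' by (intro that[of U' V \<Phi> g]) (auto simp: \<Phi>_def)
qed

lemma smooth_embedded_hypersurface_level_set:
  fixes f :: "real ^ 'n::finite \<Rightarrow> real"
  assumes "open S" "smooth_on S f"
    and "\<And>x. x \<in> S \<Longrightarrow> f x = t \<Longrightarrow> \<exists>k. frechet_derivative f (at x) (axis k 1) \<noteq> 0"
  shows "smooth_embedded_hypersurface {x \<in> S. f x = t}"
  unfolding smooth_embedded_hypersurface_def
proof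
  fix x assume "x \<in> {x \<in> S. f x = t}"
  then have x: "x \<in> S" "f x = t" by auto
  obtain k where k: "frechet_derivative f (at x) (axis k 1) \<noteq> 0" using assms(3)[OF x] by blast
  obtain W W' \<Phi> \<Psi> where *: "x \<in> W" "W \<subseteq> S" "smooth_diffeomorphism W W' \<Phi> \<Psi>"
    "\<And>x. \<Phi> x $ k = f x - t"
    using level_set_slice_chart[OF assms(1,2) x(1) k] by metis
  have "\<Phi> ` W = W'"
    using *(3) by (simp add: smooth_diffeomorphism_def homeomorphism_def)
  then have "\<Phi> ` ({x \<in> S. f x = t} \<inter> W) = {y \<in> W'. y $ k = 0}"
    using *(2,4) by force
  with * show "\<exists>W W' \<Phi> \<Psi> k. x \<in> W \<and> smooth_diffeomorphism W W' \<Phi> \<Psi> \<and>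
        \<Phi> ` ({x \<in> S. f x = t} \<inter> W) = {y \<in> W'. y $ k = 0}"
    by blast
qed

section \<open>Integration by parts\<close>

lemma integral_lborel_translation:
  fixes f :: "'a::euclidean_space \<Rightarrow> real"
  assumes "f \<in> borel_measurable borel"
  shows "(\<integral>x. f (x + c) \<partial>lborel) = (\<integral>x. f x \<partial>lborel)"
proof -
  have "(\<integral>x. f x \<partial>lborel) = (\<integral>x. f x \<partial>distr lborel borel ((+) c))"
    by (simp add: lborel_distr_plus)
  also have "\<dots> = (\<integral>x. f (c + x) \<partial>lborel)"
    by (rule integral_distr) (use assms in auto)
  finally show ?thesis by (simp add: add.commute)
qed

text \<open>The fundamental theorem for the gauge integral holds for every derivative, so
  \<open>D\<close> may be discontinuous. Boundedness and measurability then identify the result with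
  a Lebesgue integral.\<close>

lemma integral_line_derivative:
  fixes h D :: "'a::euclidean_space \<Rightarrow> real"
  assumes der: "\<And>x. ((\<lambda>s. h (x + s *\<^sub>R e)) has_real_derivative D x) (at 0)"
    and D: "D \<in> borel_measurable borel" "\<And>x. \<bar>D x\<bar> \<le> K"
  shows "(\<integral>s. indicator {0..1} s * D (x + s *\<^sub>R e) \<partial>lborel) = h (x + e) - h x"
proof -
  have "((\<lambda>s. h (x + s *\<^sub>R e)) has_real_derivative D (x + s *\<^sub>R e)) (at s)" for s
    using der[of "x + s *\<^sub>R e"] DERIV_shift[of "\<lambda>s. h (x + s *\<^sub>R e)" "D (x + s *\<^sub>R e)" 0 s]
    by (simp add: algebra_simps)
  then have "((\<lambda>s. D (x + s *\<^sub>R e)) has_integral h (x + 1 *\<^sub>R e) - h (x + 0 *\<^sub>R e)) {0..1}"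
    by (intro fundamental_theorem_of_calculus)
      (auto simp flip: has_real_derivative_iff_has_vector_derivative intro: has_field_derivative_at_within)
  moreover have "set_integrable lborel {0..1} (\<lambda>s. D (x + s *\<^sub>R e))"
    unfolding set_integrable_def
    by (rule integrableI_bounded_set_indicator[where B = K])
      (use D in \<open>auto intro!: measurable_compose[OF _ D(1)] simp: emeasure_lborel_Icc_eq\<close>)
  ultimately show ?thesis
    by (auto dest!: set_borel_integral_eq_integral(2) integral_unique simp: set_lebesgue_integral_def)
qed

lemma continuous_on_compact_norm_bound:
  fixes f :: "'a::topological_space \<Rightarrow> 'b::real_normed_vector"
  assumes "continuous_on UNIV f" "compact C"
  obtains B where "\<And>x. x \<in> C \<Longrightarrow> norm (f x) \<le> B"
proof -
  have "bounded (f ` C)"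
    by (intro compact_imp_bounded compact_continuous_image continuous_on_subset[OF assms(1)] assms(2) subset_UNIV)
  then show thesis using that unfolding bounded_iff by blast
qed

text \<open>Averaging over the translations by \<open>s *\<^sub>R e\<close>, \<open>0 \<le> s \<le> 1\<close>, reduces this to the fundamental
  theorem of calculus without splitting off a coordinate.\<close>

lemma integral_directional_derivative_eq_0:
  fixes h D :: "'a::euclidean_space \<Rightarrow> real"
  assumes der: "\<And>x. ((\<lambda>s. h (x + s *\<^sub>R e)) has_real_derivative D x) (at 0)"
    and D: "D \<in> borel_measurable borel" "\<And>x. \<bar>D x\<bar> \<le> K"
    and h: "continuous_on UNIV h"
    and supp: "\<And>x. x \<notin> cball 0 R \<Longrightarrow> h x = 0 \<and> D x = 0"
  shows "(\<integral>x. D x \<partial>lborel) = 0"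
proof -
  let ?F = "\<lambda>(s, x). indicator {0..1} s * D (x + s *\<^sub>R e)"
  have [measurable]: "D \<in> borel_measurable borel" "h \<in> borel_measurable borel"
    using D h by (auto intro: borel_measurable_continuous_onI)
  obtain B where B: "\<And>x. \<bar>h x\<bar> \<le> B"
  proof -
    obtain B where "\<And>x. x \<in> cball 0 R \<Longrightarrow> \<bar>h x\<bar> \<le> B"
      using continuous_on_compact_norm_bound[OF h compact_cball] by (metis real_norm_def)
    then have "\<bar>h x\<bar> \<le> max B 0" for x
      using supp[of x] by (cases "x \<in> cball 0 R") (auto intro: max.coboundedI1)
    then show thesis by (rule that)
  qed
  \<comment> \<open>Fubini needs joint integrability: translations by at most \<open>norm e\<close>
    keep the support within radius \<open>R + norm e\<close>.\<close>
  have "integrable (lborel \<Otimes>\<^sub>M lborel) ?F"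
  proof (rule integrableI_bounded_set[where A = "{0..1::real} \<times> cball 0 (R + norm e)" and B = K])
    show "emeasure (lborel \<Otimes>\<^sub>M lborel) ({0..1::real} \<times> cball (0::'a) (R + norm e)) < \<infinity>"
      by (subst lborel.emeasure_pair_measure_Times)
        (auto simp: emeasure_lborel_Icc_eq ennreal_mult_less_top emeasure_lborel_cball_finite[unfolded infinity_ennreal_def])
    have "D (x + s *\<^sub>R e) = 0" if "s \<in> {0..1::real}" "x \<notin> cball 0 (R + norm e)" for s x
    proof -
      have "norm x \<le> norm (x + s *\<^sub>R e) + s * norm e"
        using norm_triangle_ineq4[of "x + s *\<^sub>R e" "s *\<^sub>R e"] that by simp
      moreover have "s * norm e \<le> norm e"
        using that by (auto intro: mult_left_le_one_le)
      ultimately show ?thesis using that by (intro supp[THEN conjunct2]) auto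
    qed
    note z = this
    have "?F q = 0" if "q \<notin> {0..1::real} \<times> cball 0 (R + norm e)" for q
      using z[of "fst q" "snd q"] that by (cases q) (auto simp: indicator_def)
    then show "AE q in lborel \<Otimes>\<^sub>M lborel. q \<notin> {0..1::real} \<times> cball 0 (R + norm e) \<longrightarrow> ?F q = 0"
      by (intro AE_I2 impI)
  qed (use D in \<open>auto intro!: AE_I2 simp: indicator_def\<close>)
  from lborel_pair.Fubini_integral[OF this]
  have "(\<integral>x. \<integral>s. indicator {0..1} s * D (x + s *\<^sub>R e) \<partial>lborel \<partial>lborel) =
      (\<integral>s. \<integral>x. indicator {0..1} s * D (x + s *\<^sub>R e) \<partial>lborel \<partial>lborel)" by simp
  also have "\<dots> = (\<integral>s. indicator {0..1::real} s * (\<integral>x. D x \<partial>lborel) \<partial>lborel)"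
    by (simp add: integral_lborel_translation)
  also have "\<dots> = (\<integral>x. D x \<partial>lborel)" by simp
  finally have "(\<integral>x. D x \<partial>lborel) = (\<integral>x. h (x + e) - h x \<partial>lborel)"
    by (simp add: integral_line_derivative[OF der D])
  also have "\<dots> = (\<integral>x. h (x + e) \<partial>lborel) - (\<integral>x. h x \<partial>lborel)"
  proof (rule Bochner_Integration.integral_diff)
    show "integrable lborel h"
      by (rule integrableI_bounded_set[where A = "cball 0 R" and B = B])
       (use B supp in \<open>auto intro!: AE_I2 simp: emeasure_lborel_cball_finite[unfolded infinity_ennreal_def]\<close>)
    show "integrable lborel (\<lambda>x. h (x + e))"
    proof (rule integrableI_bounded_set[where A = "cball (- e) R" and B = B])
      show "AE x in lborel. x \<notin> cball (- e) R \<longrightarrow> h (x + e) = 0"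
        using supp by (intro AE_I2) (auto simp: dist_norm norm_minus_commute add.commute)
    qed (use B in \<open>auto intro!: AE_I2 simp: emeasure_lborel_cball_finite[unfolded infinity_ennreal_def]\<close>)
  qed
  also have "\<dots> = 0" by (simp add: integral_lborel_translation)
  finally show ?thesis .
qed

section \<open>Test functions, and integration by parts against them\<close>

lemma test_function_derivative:
  assumes "test_function \<Omega> \<phi>"
  shows "(\<phi> has_derivative frechet_derivative \<phi> (at x)) (at x)"
    "continuous_on UNIV \<phi>" "continuous_on UNIV (partial_deriv i \<phi>)"
proof -
  have Ck: "Ck_on k UNIV \<phi>" for k
    using assms by (simp add: test_function_def smooth_on_def)
  show "(\<phi> has_derivative frechet_derivative \<phi> (at x)) (at x)"
    using Ck_on_SucD(1)[OF Ck] by blast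
  show "continuous_on UNIV \<phi>" using Ck[of 0] by simp
  show "continuous_on UNIV (partial_deriv i \<phi>)"
    using Ck_on_SucD(2)[OF Ck, of 0] by (simp add: partial_deriv_def[abs_def])
qed

lemma test_function_bounds:
  assumes "test_function \<Omega> \<phi>"
  obtains R B where "\<And>x. x \<notin> cball 0 R \<Longrightarrow> \<phi> x = 0 \<and> partial_deriv i \<phi> x = 0"
    "\<And>x. norm (\<phi> x) \<le> B \<and> norm (partial_deriv i \<phi> x) \<le> B"
    "\<And>x. x \<notin> \<Omega> \<Longrightarrow> \<phi> x = 0 \<and> partial_deriv i \<phi> x = 0"
proof -
  define C where "C = closure {x. \<phi> x \<noteq> 0}"
  have C: "compact C" "C \<subseteq> \<Omega>" using assms by (auto simp: test_function_def C_def)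
  have \<phi>0: "\<phi> x = 0" if "x \<notin> C" for x
    using that closure_subset[of "{x. \<phi> x \<noteq> 0}"] unfolding C_def by blast
  have 0: "\<phi> x = 0 \<and> partial_deriv i \<phi> x = 0" if "x \<notin> C" for x
  proof
    have "(\<phi> has_derivative (\<lambda>x. 0)) (at x)"
      by (rule has_derivative_transform_within_open[OF has_derivative_const open_Compl[OF compact_imp_closed[OF C(1)]]])
        (use that \<phi>0 in auto)
    from frechet_derivative_at[OF this, symmetric] show "partial_deriv i \<phi> x = 0"
      by (simp add: partial_deriv_def)
  qed (rule \<phi>0[OF that])
  obtain R where R: "C \<subseteq> cball 0 R"
    using bounded_subset_ballD[OF compact_imp_bounded[OF C(1)], of 0] ball_subset_cball by (metis subset_trans)
  obtain B where B: "\<And>x. x \<in> C \<Longrightarrow> norm (\<phi> x) \<le> B"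
    using continuous_on_compact_norm_bound[OF test_function_derivative(2)[OF assms] C(1)] by metis
  obtain B' where B': "\<And>x. x \<in> C \<Longrightarrow> norm (partial_deriv i \<phi> x) \<le> B'"
    using continuous_on_compact_norm_bound[OF test_function_derivative(3)[OF assms] C(1)] by metis
  show thesis
  proof (rule that[of R "max 0 (max B B')"])
    show "norm (\<phi> x) \<le> max 0 (max B B') \<and> norm (partial_deriv i \<phi> x) \<le> max 0 (max B B')" for x
      using 0[of x] B[of x] B'[of x] by (cases "x \<in> C") auto
  qed (use 0 R C(2) in blast)+
qed

text \<open>The product \<open>w x * \<psi> x\<close> has compact support, and its derivative along
  \<open>axis i 1\<close> is the sum of the two integrands, so that sum integrates to 0.
  \<open>w\<close> need only be bounded on the support of \<open>\<psi>\<close>, and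
  \<open>G\<close> need not be continuous.\<close>

lemma integral_by_parts_test_function:
  fixes w :: "real ^ 'n::finite \<Rightarrow> real"
  assumes w: "\<And>x. (w has_derivative (\<lambda>v. G x \<bullet> v)) (at x)"
    and G: "G \<in> borel_measurable borel" "\<And>x. norm (G x) \<le> K"
    and \<psi>: "test_function \<Omega> \<psi>"
  shows "integrable lborel (\<lambda>x. w x * partial_deriv i \<psi> x)"
    "integrable lborel (\<lambda>x. G x $ i * \<psi> x)"
    "(\<integral>x. w x * partial_deriv i \<psi> x \<partial>lborel) = - (\<integral>x. G x $ i * \<psi> x \<partial>lborel)"
proof -
  obtain R B where R: "\<And>x. x \<notin> cball 0 R \<Longrightarrow> \<psi> x = 0 \<and> partial_deriv i \<psi> x = 0"
    and B: "\<And>x. norm (\<psi> x) \<le> B \<and> norm (partial_deriv i \<psi> x) \<le> B"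
    using test_function_bounds[OF \<psi>, of i] by metis
  have B0: "0 \<le> B" using B[of 0] norm_ge_zero order_trans by blast
  have K0: "0 \<le> K" using G(2)[of 0] norm_ge_zero order_trans by blast
  have wc: "continuous_on UNIV w"
    using w by (auto intro!: has_derivative_continuous_on intro: has_derivative_at_withinI)
  note \<psi>' = test_function_derivative[OF \<psi>]
  have [measurable]: "w \<in> borel_measurable borel" "\<psi> \<in> borel_measurable borel"
    "partial_deriv i \<psi> \<in> borel_measurable borel"
    using wc \<psi>' by (auto intro: borel_measurable_continuous_onI)
  have [measurable]: "(\<lambda>x. G x $ i) \<in> borel_measurable borel"
    by (rule measurable_compose[OF G(1) borel_measurable_continuous_onI]) (intro continuous_intros)
  obtain A where A: "\<And>x. x \<in> cball 0 R \<Longrightarrow> \<bar>w x\<bar> \<le> A"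
    using continuous_on_compact_norm_bound[OF wc compact_cball] by (metis real_norm_def)
  have Gi: "\<bar>G x $ i\<bar> \<le> K" for x
    using G(2)[of x] component_le_norm_cart[of "G x" i] by simp
  have b1: "\<bar>w x * partial_deriv i \<psi> x\<bar> \<le> \<bar>A\<bar> * B" for x
    using R[of x] A[of x] B[of x] B0
    by (cases "x \<in> cball 0 R") (auto simp: abs_mult intro!: mult_mono)
  have b2: "\<bar>G x $ i * \<psi> x\<bar> \<le> K * B" for x
    using Gi B[of x] K0 by (auto simp: abs_mult intro!: mult_mono)
  show I1: "integrable lborel (\<lambda>x. w x * partial_deriv i \<psi> x)"
    by (rule integrableI_bounded_set[where A = "cball 0 R" and B = "\<bar>A\<bar> * B"])
      (use R b1 in \<open>auto intro!: AE_I2 simp: emeasure_lborel_cball_finite[unfolded infinity_ennreal_def]\<close>)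
  show I2: "integrable lborel (\<lambda>x. G x $ i * \<psi> x)"
    by (rule integrableI_bounded_set[where A = "cball 0 R" and B = "K * B"])
      (use R b2 in \<open>auto intro!: AE_I2 simp: emeasure_lborel_cball_finite[unfolded infinity_ennreal_def]\<close>)
  have "(\<integral>x. w x * partial_deriv i \<psi> x + G x $ i * \<psi> x \<partial>lborel) = 0"
  proof (rule integral_directional_derivative_eq_0[where h = "\<lambda>x. w x * \<psi> x" and e = "axis i 1"
        and R = R and K = "\<bar>A\<bar> * B + K * B"])
    fix x
    have A: "((\<lambda>s. x + s *\<^sub>R axis i 1) has_derivative (\<lambda>s. s *\<^sub>R axis i (1::real))) (at 0)"
      by (auto intro!: derivative_eq_intros)
    have B: "((\<lambda>x. w x * \<psi> x) has_derivative (\<lambda>v. w x * frechet_derivative \<psi> (at x) v + (G x \<bullet> v) * \<psi> x))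
        (at (x + 0 *\<^sub>R axis i 1))"
      using has_derivative_mult[OF w \<psi>'(1)] by simp
    have "((\<lambda>s. w (x + s *\<^sub>R axis i 1) * \<psi> (x + s *\<^sub>R axis i 1)) has_derivative
        (\<lambda>s. w x * frechet_derivative \<psi> (at x) (s *\<^sub>R axis i 1) + (G x \<bullet> s *\<^sub>R axis i 1) * \<psi> x)) (at 0)"
      using diff_chain_at[OF A B] by (simp add: o_def)
    moreover have "frechet_derivative \<psi> (at x) (s *\<^sub>R axis i 1) = s * partial_deriv i \<psi> x" for s
      using linear_cmul[OF has_derivative_linear[OF \<psi>'(1)]] by (simp add: partial_deriv_def)
    then have "(\<lambda>s. w x * frechet_derivative \<psi> (at x) (s *\<^sub>R axis i 1) + (G x \<bullet> s *\<^sub>R axis i 1) * \<psi> x) =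
        (*) (w x * partial_deriv i \<psi> x + G x $ i * \<psi> x)"
      by (intro ext) (simp add: inner_axis algebra_simps)
    ultimately show "((\<lambda>s. w (x + s *\<^sub>R axis i 1) * \<psi> (x + s *\<^sub>R axis i 1)) has_real_derivative
         w x * partial_deriv i \<psi> x + G x $ i * \<psi> x) (at 0)"
      unfolding has_field_derivative_def by (simp only:)
    show "\<bar>w x * partial_deriv i \<psi> x + G x $ i * \<psi> x\<bar> \<le> \<bar>A\<bar> * B + K * B"
      using b1[of x] b2[of x] by linarith
  qed (use R wc \<psi>' in \<open>auto intro!: continuous_intros\<close>)
  then show "(\<integral>x. w x * partial_deriv i \<psi> x \<partial>lborel) = - (\<integral>x. G x $ i * \<psi> x \<partial>lborel)"
    using I1 I2 by simp
qed

lemma test_function_component: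
  fixes \<phi> :: "real ^ 'n::finite \<Rightarrow> real ^ 'n"
  assumes "test_function \<Omega> \<phi>"
  shows "test_function \<Omega> (\<lambda>x. \<phi> x $ i)"
    "partial_deriv j (\<lambda>x. \<phi> x $ i) x = partial_deriv j \<phi> x $ i"
proof -
  have sub: "closure {x. \<phi> x $ i \<noteq> 0} \<subseteq> closure {x. \<phi> x \<noteq> 0}"
    by (rule closure_mono) auto
  have "compact (closure {x. \<phi> x \<noteq> 0} \<inter> closure {x. \<phi> x $ i \<noteq> 0})"
    using assms by (intro compact_Int_closed) (auto simp: test_function_def)
  then have "compact (closure {x. \<phi> x $ i \<noteq> 0})"
    using sub by (simp add: inf.absorb2)
  moreover have "Ck_on k UNIV (\<lambda>x. \<phi> x $ i)" for k
    using assms by (intro Ck_on_compose_linear[OF open_UNIV bounded_linear_vec_nth])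
      (simp add: test_function_def smooth_on_def)
  ultimately show "test_function \<Omega> (\<lambda>x. \<phi> x $ i)"
    using assms sub unfolding test_function_def smooth_on_def by blast
  have "((\<lambda>x. \<phi> x $ i) has_derivative (\<lambda>v. frechet_derivative \<phi> (at x) v $ i)) (at x)"
    by (rule bounded_linear.has_derivative[OF bounded_linear_vec_nth test_function_derivative(1)[OF assms]])
  then show "partial_deriv j (\<lambda>x. \<phi> x $ i) x = partial_deriv j \<phi> x $ i"
    by (simp add: partial_deriv_def flip: frechet_derivative_at)
qed

lemma integral_by_parts_divergence:
  fixes w :: "real ^ 'n::finite \<Rightarrow> real"
  assumes w: "\<And>x. (w has_derivative (\<lambda>v. G x \<bullet> v)) (at x)"
    and G: "G \<in> borel_measurable borel" "\<And>x. norm (G x) \<le> K"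
    and \<phi>: "test_function \<Omega> \<phi>"
  shows "integrable lborel (\<lambda>x. w x * divergence \<phi> x)"
    "(\<integral>x. w x * divergence \<phi> x \<partial>lborel) = - (\<integral>x. G x \<bullet> \<phi> x \<partial>lborel)"
proof -
  note I = integral_by_parts_test_function[OF w G test_function_component(1)[OF \<phi>],
      unfolded test_function_component(2)[OF \<phi>]]
  have eq: "w x * divergence \<phi> x = (\<Sum>i\<in>UNIV. w x * partial_deriv i \<phi> x $ i)" for x
    by (simp add: divergence_def sum_distrib_left)
  show "integrable lborel (\<lambda>x. w x * divergence \<phi> x)"
    unfolding eq using I(1) by auto
  show "(\<integral>x. w x * divergence \<phi> x \<partial>lborel) = - (\<integral>x. G x \<bullet> \<phi> x \<partial>lborel)"
    unfolding eq inner_vec_def using I by (simp add: sum_negf)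
qed

section \<open>A coarea inequality for superlevel sets\<close>

text \<open>The C^1 quadratic spline from 0 to 1 with knots 0, 1/2 and 1, in truncated powers; its
  derivative is the hat function of height 2. A piecewise linear cutoff could make
  \<open>ramp (m * (u x - t))\<close> fail to be differentiable at some points, which the
  integration by parts does not tolerate.\<close>

definition ramp :: "real \<Rightarrow> real" where
  "ramp r = 2 * (max 0 r)\<^sup>2 - 4 * (max 0 (r - 1/2))\<^sup>2 + 2 * (max 0 (r - 1))\<^sup>2"

definition ramp_deriv :: "real \<Rightarrow> real" where
  "ramp_deriv r = 4 * max 0 r - 8 * max 0 (r - 1/2) + 4 * max 0 (r - 1)"

lemma has_real_derivative_max0_square:
  "((\<lambda>r. (max 0 (r - c))\<^sup>2) has_real_derivative 2 * max 0 (r - c)) (at (r::real))"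
proof -
  consider "r > c" | "r < c" | "r = c" by linarith
  then show ?thesis
  proof cases
    case 1
    have "((\<lambda>r. (r - c)\<^sup>2) has_real_derivative 2 * max 0 (r - c)) (at r)"
      using 1 by (auto intro!: derivative_eq_intros)
    then show ?thesis
      by (rule has_field_derivative_transform_within_open[where S = "{c<..}"]) (use 1 in auto)
  next
    case 2
    have "((\<lambda>r. 0) has_real_derivative 2 * max 0 (r - c)) (at r)"
      using 2 by simp
    then show ?thesis
      by (rule has_field_derivative_transform_within_open[where S = "{..<c}"]) (use 2 in auto)
  next
    case 3
    have "\<bar>(max 0 h)\<^sup>2 / h\<bar> \<le> \<bar>h\<bar>" for h :: real
      by (auto simp: max_def power2_eq_square)
    then have "((\<lambda>h::real. (max 0 h)\<^sup>2 / h) \<longlongrightarrow> 0) (at 0)"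
      by (intro Lim_null_comparison[OF _ tendsto_rabs_zero[OF tendsto_ident_at]] always_eventually) simp
    then show ?thesis by (simp add: DERIV_def 3)
  qed
qed

lemma ramp_has_derivative: "(ramp has_real_derivative ramp_deriv r) (at r)"
proof -
  have "((\<lambda>r. 2 * (max 0 (r - 0))\<^sup>2 - 4 * (max 0 (r - 1/2))\<^sup>2 + 2 * (max 0 (r - 1))\<^sup>2) has_real_derivative
      2 * (2 * max 0 (r - 0)) - 4 * (2 * max 0 (r - 1/2)) + 2 * (2 * max 0 (r - 1))) (at r)"
    by (intro DERIV_add DERIV_diff DERIV_cmult has_real_derivative_max0_square)
  then show ?thesis by (simp add: ramp_def[abs_def] ramp_deriv_def)
qed

lemma ramp_deriv_bounds: "0 \<le> ramp_deriv r" "ramp_deriv r \<le> 2" "r \<notin> {0<..<1} \<Longrightarrow> ramp_deriv r = 0"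
  by (auto simp: ramp_deriv_def max_def)

lemma ramp_values: "r \<le> 0 \<Longrightarrow> ramp r = 0" "1 \<le> r \<Longrightarrow> ramp r = 1"
  by (auto simp: ramp_def max_def power2_eq_square algebra_simps)

lemma ramp_bounds: "0 \<le> ramp r" "ramp r \<le> 1"
proof -
  have mono: "ramp a \<le> ramp b" if "a \<le> b" for a b
    by (rule DERIV_nonneg_imp_nondecreasing[OF that])
      (use ramp_has_derivative ramp_deriv_bounds(1) in blast)
  show "0 \<le> ramp r" using mono[of "min r 0" r] ramp_values(1)[of "min r 0"] by simp
  show "ramp r \<le> 1" using mono[of r "max r 1"] ramp_values(2)[of "max r 1"] by simp
qed

text \<open>The ramp rises to the right of 0 instead of being centred there, so the limit is correct
  at \<open>s = 0\<close> too: strict superlevel sets are approximated at every point, not just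
  almost everywhere.\<close>

lemma ramp_tendsto_indicator: "(\<lambda>m. ramp (real (Suc m) * s)) \<longlonglongrightarrow> indicator {0<..} s"
proof (cases "s > 0")
  case True
  obtain n where n: "1 < real n * s" using reals_Archimedean3[OF True] by metis
  have "1 \<le> real (Suc m) * s" if "n \<le> m" for m
  proof -
    have "real n * s \<le> real (Suc m) * s" using that True by (intro mult_right_mono) auto
    with n show ?thesis by linarith
  qed
  then have "eventually (\<lambda>m. 1 \<le> real (Suc m) * s) sequentially"
    by (rule eventually_sequentiallyI)
  then have "eventually (\<lambda>m. ramp (real (Suc m) * s) = indicator {0<..} s) sequentially"
    by eventually_elim (use True in \<open>simp add: ramp_values\<close>)
  then show ?thesis by (rule tendsto_eventually)
next
  case False
  then show ?thesis by (simp add: ramp_values mult_nonneg_nonpos)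
qed

section \<open>Bounded functions on bounded sets: integrability and L^p norms\<close>

lemma set_integrable_lebesgue_bounded:
  fixes f :: "'a::euclidean_space \<Rightarrow> 'b::euclidean_space"
  assumes "A \<in> sets borel" "bounded A" "f \<in> borel_measurable borel" "\<And>x. x \<in> A \<Longrightarrow> norm (f x) \<le> B"
  shows "set_integrable lebesgue A f"
proof -
  have "integrable lborel (\<lambda>x. indicator A x *\<^sub>R f x)"
    by (rule integrableI_bounded_set_indicator[where B = B])
      (use assms emeasure_bounded_finite[OF assms(2)] in auto)
  then show ?thesis
    unfolding set_integrable_def using assms by (subst integrable_completion) auto
qed

lemma set_integral_lebesgue_eq:
  fixes f :: "'a::euclidean_space \<Rightarrow> 'b::euclidean_space"
  assumes "A \<in> sets borel" "f \<in> borel_measurable borel" "\<And>x. x \<notin> A \<Longrightarrow> f x = 0"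
  shows "(LINT x:A|lebesgue. f x) = (\<integral>x. f x \<partial>lborel)"
proof -
  have "(\<lambda>x. indicator A x *\<^sub>R f x) = f" using assms(3) by (auto simp: indicator_def)
  then show ?thesis
    unfolding set_lebesgue_integral_def using assms by (simp add: integral_completion)
qed

lemma in_Lp_bounded:
  fixes f :: "'a::euclidean_space \<Rightarrow> 'b::euclidean_space"
  assumes "A \<in> sets borel" "bounded A" "f \<in> borel_measurable borel" "\<And>x. x \<in> A \<Longrightarrow> norm (f x) \<le> B"
    and "0 \<le> p"
  shows "in_Lp p A f"
  unfolding in_Lp_def
proof
  show "set_borel_measurable lebesgue A f"
    unfolding set_borel_measurable_def using assms by (intro measurable_completion) auto
  show "set_integrable lebesgue A (\<lambda>x. norm (f x) powr p)"
    by (rule set_integrable_lebesgue_bounded[where B = "B powr p"])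
      (use assms in \<open>auto intro!: powr_mono2\<close>)
qed

lemma Lp_norm_tendsto_0:
  fixes f :: "nat \<Rightarrow> 'a::euclidean_space \<Rightarrow> 'b::euclidean_space"
  assumes A: "A \<in> sets borel" "bounded A" and f: "\<And>N. f N \<in> borel_measurable borel"
    and B: "\<And>N x. x \<in> A \<Longrightarrow> norm (f N x) \<le> B"
    and lim: "\<And>x. x \<in> A \<Longrightarrow> (\<lambda>N. f N x) \<longlonglongrightarrow> 0" and p: "1 \<le> p"
  shows "(\<lambda>N. Lp_norm p A (f N)) \<longlonglongrightarrow> 0"
proof -
  have "(\<lambda>N. (\<integral>x. indicator A x *\<^sub>R norm (f N x) powr p \<partial>lebesgue)) \<longlonglongrightarrow> (\<integral>x. 0 \<partial>(lebesgue :: 'a measure))"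
  proof (rule integral_dominated_convergence[where w = "\<lambda>x. indicator A x *\<^sub>R B powr p"])
    show "integrable lebesgue (\<lambda>x. indicator A x *\<^sub>R B powr p)"
      using set_integrable_lebesgue_bounded[OF A, of "\<lambda>_. B powr p"] by (auto simp: set_integrable_def)
    show "(\<lambda>x. indicator A x *\<^sub>R norm (f N x) powr p) \<in> borel_measurable lebesgue" for N
      using A f by (intro measurable_completion) auto
    show "AE x in lebesgue. (\<lambda>N. indicator A x *\<^sub>R norm (f N x) powr p) \<longlonglongrightarrow> 0"
    proof (intro AE_I2)
      fix x
      have "(\<lambda>N. norm (f N x) powr p) \<longlonglongrightarrow> 0" if "x \<in> A"
        using tendsto_norm_zero[OF lim[OF that]] p
        by (intro tendsto_zero_powrI[where b = p]) auto
      then show "(\<lambda>N. indicator A x *\<^sub>R norm (f N x) powr p) \<longlonglongrightarrow> 0"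
        by (cases "x \<in> A") auto
    qed
    show "AE x in lebesgue. norm (indicator A x *\<^sub>R norm (f N x) powr p) \<le> indicator A x *\<^sub>R B powr p" for N
      using B p by (intro AE_I2) (auto simp: indicator_def intro!: powr_mono2)
  qed auto
  then have "(\<lambda>N. LINT x:A|lebesgue. norm (f N x) powr p) \<longlonglongrightarrow> 0"
    by (simp add: set_lebesgue_integral_def)
  then show ?thesis
    unfolding Lp_norm_def
    by (rule tendsto_zero_powrI[where b = "1 / p"])
      (use p in \<open>auto intro!: always_eventually Bochner_Integration.integral_nonneg simp: set_lebesgue_integral_def\<close>)
qed

text \<open>The admissible \<open>t\<close> form an interval of length 1/m, which cancels the factor
  \<open>m\<close> that the chain rule produces.\<close>

lemma emeasure_ramp_window:
  fixes a :: real
  assumes "m > 0"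
  shows "(\<integral>\<^sup>+t. ennreal m * indicator {0<..<1} (m * (a - t)) \<partial>lborel) = 1"
proof -
  have "indicator {0<..<1} (m * (a - t)) = (indicator {a - 1/m<..<a} t :: ennreal)" for t
    using assms by (auto simp: indicator_def field_simps)
  then have "(\<integral>\<^sup>+t. ennreal m * indicator {0<..<1} (m * (a - t)) \<partial>lborel) = ennreal m * ennreal (1 / m)"
    using assms by (simp add: nn_integral_cmult)
  then show ?thesis using assms by (simp flip: ennreal_mult)
qed

text \<open>A coarea inequality: \<open>ramp (m * (u x - t))\<close> approximates the indicator of \<open>{u > t}\<close>, and the
  \<open>t\<close>-integral of its gradient is at most \<open>2 * norm (Du x)\<close>, uniformly in \<open>m\<close>; Fatou's lemma
  yields the bound \<open>P\<close>.\<close>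

lemma superlevel_divergence_bound:
  fixes u v :: "real ^ 'n::finite \<Rightarrow> real"
  assumes u: "\<And>x. (u has_derivative (\<lambda>w. Gu x \<bullet> w)) (at x)"
    and v: "\<And>x. (v has_derivative (\<lambda>w. Gv x \<bullet> w)) (at x)"
    and Gu: "Gu \<in> borel_measurable borel" "\<And>x. norm (Gu x) \<le> K"
    and Gv: "Gv \<in> borel_measurable borel" "\<And>x. norm (Gv x) \<le> K"
    and S: "S \<in> sets borel" "\<And>x. x \<notin> S \<Longrightarrow> u x = v x \<and> Gu x = Gv x"
    and \<Omega>: "open \<Omega>"
  obtains P :: "real \<Rightarrow> ennreal" where "P \<in> borel_measurable borel"
    "(\<integral>\<^sup>+t. P t \<partial>lborel) \<le> ennreal (4 * K) * emeasure lborel (\<Omega> \<inter> S)"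
    "\<And>t \<phi>. test_function \<Omega> \<phi> \<Longrightarrow> (\<And>x. norm (\<phi> x) \<le> 1) \<Longrightarrow>
      ennreal \<bar>distributional_gradient \<Omega> (indicator {x \<in> \<Omega>. u x > t}) \<phi> -
        distributional_gradient \<Omega> (indicator {x \<in> \<Omega>. v x > t}) \<phi>\<bar> \<le> P t"
proof -
  have K: "0 \<le> K" using Gu(2)[of 0] norm_ge_zero order_trans by blast
  have uc: "continuous_on UNIV u" "continuous_on UNIV v"
    using u v by (auto intro!: has_derivative_continuous_on intro: has_derivative_at_withinI)
  have [measurable]: "u \<in> borel_measurable borel" "v \<in> borel_measurable borel"
    "Gu \<in> borel_measurable borel" "Gv \<in> borel_measurable borel" "S \<in> sets borel" "\<Omega> \<in> sets borel"
    using uc Gu Gv S \<Omega> by (auto intro: borel_measurable_continuous_onI)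
  \<comment> \<open>\<open>q\<close> marks where the two cutoffs have nonzero slope. In
    \<open>Q\<close> the factor 2 bounds \<open>ramp_deriv\<close>, \<open>K\<close> bounds the
    gradients, and the restriction to \<open>S\<close> is allowed because the two terms cancel
    elsewhere. Each window contributes 1 to the \<open>t\<close>-integral, whence 4 * K for every
    \<open>m\<close>.\<close>
  define q where "q m t x = ennreal m * indicator {0<..<1} (m * (u x - t)) +
    ennreal m * indicator {0<..<1} (m * (v x - t))" for m t :: real and x
  define Q where "Q m t = (\<integral>\<^sup>+x. ennreal (2 * K) * indicator (\<Omega> \<inter> S) x * q m t x \<partial>lborel)" for m t :: real
  have qm [measurable]: "(\<lambda>(t, x). q m t x) \<in> borel_measurable (borel \<Otimes>\<^sub>M borel)" for m
    unfolding q_def by measurable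
  have Qm: "Q m \<in> borel_measurable borel" for m
  proof -
    have "(\<lambda>t. \<integral>\<^sup>+x. ennreal (2 * K) * indicator (\<Omega> \<inter> S) x * q m t x \<partial>lborel) \<in> borel_measurable (borel :: real measure)"
      by measurable
    then show ?thesis by (simp add: Q_def[abs_def])
  qed
  have Qint: "(\<integral>\<^sup>+t. Q m t \<partial>lborel) = ennreal (4 * K) * emeasure lborel (\<Omega> \<inter> S)" if "m > 0" for m
  proof -
    have "(\<integral>\<^sup>+t. Q m t \<partial>lborel) =
        (\<integral>\<^sup>+x. \<integral>\<^sup>+t. ennreal (2 * K) * indicator (\<Omega> \<inter> S) x * q m t x \<partial>lborel \<partial>lborel)"
      unfolding Q_def
      by (rule lborel_pair.Fubini') (simp add: split_beta')
    also have "\<dots> = (\<integral>\<^sup>+x. ennreal (2 * K) * indicator (\<Omega> \<inter> S) x * 2 \<partial>lborel)"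
    proof (rule nn_integral_cong)
      fix x :: "real ^ 'n"
      have "(\<integral>\<^sup>+t. q m t x \<partial>lborel) = 1 + 1"
        unfolding q_def using that by (subst nn_integral_add) (auto simp: emeasure_ramp_window)
      then show "(\<integral>\<^sup>+t. ennreal (2 * K) * indicator (\<Omega> \<inter> S) x * q m t x \<partial>lborel) =
          ennreal (2 * K) * indicator (\<Omega> \<inter> S) x * 2"
        unfolding q_def by (subst nn_integral_cmult) auto
    qed
    also have "\<dots> = (\<integral>\<^sup>+x. ennreal (4 * K) * indicator (\<Omega> \<inter> S) x \<partial>lborel)"
    proof -
      have "ennreal (4 * K) = ennreal (2 * K * 2)" by (rule arg_cong[where f = ennreal]) simp
      also have "\<dots> = ennreal (2 * K) * ennreal 2" using K by (intro ennreal_mult) auto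
      finally show ?thesis by (intro nn_integral_cong) (simp add: mult_ac)
    qed
    finally show ?thesis by (simp add: nn_integral_cmult_indicator)
  qed
  \<comment> \<open>\<open>P\<close> does not mention a test field, so the bound survives the
    supremum in the total variation; and as \<open>P\<close> is measurable, measurability of the
    total variation in \<open>t\<close> never comes up.\<close>
  define P where "P t = liminf (\<lambda>m. Q (real (Suc m)) t)" for t
  show thesis
  proof (rule that)
    show "P \<in> borel_measurable borel"
      unfolding P_def[abs_def] using Qm by measurable
    have "(\<integral>\<^sup>+t. P t \<partial>lborel) \<le> liminf (\<lambda>m. (\<integral>\<^sup>+t. Q (real (Suc m)) t \<partial>lborel))"
      unfolding P_def by (rule nn_integral_liminf) (use Qm in simp)
    also have "\<dots> = ennreal (4 * K) * emeasure lborel (\<Omega> \<inter> S)"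
      by (simp add: Qint Liminf_const)
    finally show "(\<integral>\<^sup>+t. P t \<partial>lborel) \<le> ennreal (4 * K) * emeasure lborel (\<Omega> \<inter> S)" .
  next
    fix t :: real and \<phi> :: "real ^ 'n \<Rightarrow> real ^ 'n"
    assume \<phi>: "test_function \<Omega> \<phi>" and \<phi>1: "\<And>x. norm (\<phi> x) \<le> (1::real)"
    let ?I = "\<lambda>u x. indicator {0<..} (u x - t) :: real"
    define w where "w m x = ramp (m * (u x - t)) - ramp (m * (v x - t))" for m x
    define Gw where "Gw m x = (m * ramp_deriv (m * (u x - t))) *\<^sub>R Gu x - (m * ramp_deriv (m * (v x - t))) *\<^sub>R Gv x" for m x
    have [measurable]: "ramp_deriv \<in> borel_measurable borel" "ramp \<in> borel_measurable borel"
      unfolding ramp_deriv_def[abs_def] ramp_def[abs_def] by measurable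
    have w': "(w m has_derivative (\<lambda>y. Gw m x \<bullet> y)) (at x)" for m x
    proof -
      have r: "((\<lambda>x. ramp (m * (f x - t))) has_derivative (\<lambda>y. (m * ramp_deriv (m * (f x - t))) *\<^sub>R G x \<bullet> y)) (at x)"
        if "(f has_derivative (\<lambda>w. G x \<bullet> w)) (at x)" for f :: "real ^ 'n \<Rightarrow> real" and G
      proof -
        have "((\<lambda>x. m * (f x - t)) has_derivative (\<lambda>y. m * (G x \<bullet> y))) (at x)"
          using that by (auto intro!: derivative_eq_intros)
        from diff_chain_at[OF this ramp_has_derivative[unfolded has_field_derivative_def]]
        show ?thesis by (simp add: o_def mult_ac)
      qed
      show ?thesis
        unfolding w_def Gw_def inner_diff_left by (intro has_derivative_diff r u v)
    qed
    have Gwb: "norm (Gw m x) \<le> 4 * m * K" if "m \<ge> 0" for m x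
    proof -
      have "norm (Gw m x) \<le> (m * ramp_deriv (m * (u x - t))) * norm (Gu x) + (m * ramp_deriv (m * (v x - t))) * norm (Gv x)"
        unfolding Gw_def by (rule norm_triangle_le_diff) (use that ramp_deriv_bounds in auto)
      also have "\<dots> \<le> m * 2 * K + m * 2 * K"
        using that ramp_deriv_bounds Gu(2) Gv(2) by (intro add_mono mult_mono) auto
      finally show ?thesis by (simp add: algebra_simps)
    qed
    have [measurable]: "Gw m \<in> borel_measurable borel" for m unfolding Gw_def by measurable
    have [measurable]: "\<phi> \<in> borel_measurable borel"
      using test_function_derivative(2)[OF \<phi>] by (rule borel_measurable_continuous_onI)
    have [measurable]: "divergence \<phi> \<in> borel_measurable borel"
    proof -
      have "continuous_on UNIV (divergence \<phi>)"
        unfolding divergence_def[abs_def]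
        by (intro continuous_intros test_function_derivative(3)[OF \<phi>])
      then show ?thesis by (rule borel_measurable_continuous_onI)
    qed
    have \<phi>0: "\<phi> x = 0 \<and> divergence \<phi> x = 0" if "x \<notin> \<Omega>" for x
      using test_function_bounds[OF \<phi>] that unfolding divergence_def
      by (metis (mono_tags, lifting) sum.neutral zero_index)
    have dg: "distributional_gradient \<Omega> (indicator {x \<in> \<Omega>. f x > t}) \<phi> = - (\<integral>x. ?I f x * divergence \<phi> x \<partial>lborel)"
      if [measurable]: "f \<in> borel_measurable borel" for f
    proof -
      have "(LINT x:\<Omega>|lebesgue. indicator {x \<in> \<Omega>. f x > t} x * divergence \<phi> x) =
          (\<integral>x. indicator {x \<in> \<Omega>. f x > t} x * divergence \<phi> x \<partial>lborel)"
        by (rule set_integral_lebesgue_eq) (use \<phi>0 in auto)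
      also have "\<dots> = (\<integral>x. ?I f x * divergence \<phi> x \<partial>lborel)"
        by (rule Bochner_Integration.integral_cong) (use \<phi>0 in \<open>auto simp: indicator_def\<close>)
      finally show ?thesis by (simp add: distributional_gradient_def)
    qed
    \<comment> \<open>The constant 1 takes the role of \<open>w\<close>, only to obtain
      integrability of \<open>divergence \<phi>\<close>.\<close>
    have "((\<lambda>_. 1::real) has_derivative (\<lambda>w. 0 \<bullet> w)) (at x)" for x :: "real ^ 'n" by simp
    from integral_by_parts_divergence(1)[OF this _ _ \<phi>, of 0]
    have div: "integrable lborel (divergence \<phi>)" by simp
    have Iint: "integrable lborel (\<lambda>x. ?I f x * divergence \<phi> x)" if [measurable]: "f \<in> borel_measurable borel" for f
      by (rule Bochner_Integration.integrable_bound[OF div]) (auto simp: indicator_def)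
    define J where "J m = (\<integral>x. w m x * divergence \<phi> x \<partial>lborel)" for m
    have "(\<lambda>m. J (real (Suc m))) \<longlonglongrightarrow> (\<integral>x. (?I u x - ?I v x) * divergence \<phi> x \<partial>lborel)"
      unfolding J_def
    proof (rule integral_dominated_convergence[where w = "\<lambda>x. \<bar>divergence \<phi> x\<bar>"])
      show "AE x in lborel. (\<lambda>m. w (real (Suc m)) x * divergence \<phi> x) \<longlonglongrightarrow> (?I u x - ?I v x) * divergence \<phi> x"
        unfolding w_def by (intro AE_I2 tendsto_intros ramp_tendsto_indicator)
      have "\<bar>w m x\<bar> \<le> 1" for m x
        unfolding w_def using ramp_bounds[of "m * (u x - t)"] ramp_bounds[of "m * (v x - t)"] by linarith
      then show "AE x in lborel. norm (w (real (Suc m)) x * divergence \<phi> x) \<le> \<bar>divergence \<phi> x\<bar>" for m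
        by (intro AE_I2) (auto simp: abs_mult intro!: mult_left_le_one_le)
      show "(\<lambda>x. w (real (Suc m)) x * divergence \<phi> x) \<in> borel_measurable lborel" for m
        unfolding w_def by measurable
    qed (use div in auto)
    also have "(\<integral>x. (?I u x - ?I v x) * divergence \<phi> x \<partial>lborel) =
        - (distributional_gradient \<Omega> (indicator {x \<in> \<Omega>. u x > t}) \<phi> - distributional_gradient \<Omega> (indicator {x \<in> \<Omega>. v x > t}) \<phi>)"
      by (simp add: dg left_diff_distrib Iint)
    finally have "(\<lambda>m. J (real (Suc m))) \<longlonglongrightarrow> - (distributional_gradient \<Omega> (indicator {x \<in> \<Omega>. u x > t}) \<phi> -
        distributional_gradient \<Omega> (indicator {x \<in> \<Omega>. v x > t}) \<phi>)" .
    from tendsto_ennrealI[OF tendsto_rabs[OF this]]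
    have lim: "(\<lambda>m. ennreal \<bar>J (real (Suc m))\<bar>) \<longlonglongrightarrow> ennreal \<bar>distributional_gradient \<Omega> (indicator {x \<in> \<Omega>. u x > t}) \<phi> -
        distributional_gradient \<Omega> (indicator {x \<in> \<Omega>. v x > t}) \<phi>\<bar>"
      by (simp only: abs_minus_cancel)
    have JQ: "ennreal \<bar>J m\<bar> \<le> Q m t" if "m > 0" for m
    proof -
      have "\<bar>J m\<bar> = \<bar>\<integral>x. Gw m x \<bullet> \<phi> x \<partial>lborel\<bar>"
        unfolding J_def using that
        by (subst integral_by_parts_divergence(2)[OF w' _ Gwb \<phi>]) auto
      \<comment> \<open>A Bochner integral that does not exist is 0 by convention, so the bound
        holds without proving integrability.\<close>
      also have "ennreal \<dots> \<le> (\<integral>\<^sup>+x. ennreal \<bar>Gw m x \<bullet> \<phi> x\<bar> \<partial>lborel)"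
        using integral_norm_bound_ennreal[of lborel "\<lambda>x. Gw m x \<bullet> \<phi> x"]
        by (cases "integrable lborel (\<lambda>x. Gw m x \<bullet> \<phi> x)") (auto simp: not_integrable_integral_eq)
      also have "\<dots> \<le> Q m t"
        unfolding Q_def
      proof (rule nn_integral_mono)
        fix x
        show "ennreal \<bar>Gw m x \<bullet> \<phi> x\<bar> \<le> ennreal (2 * K) * indicator (\<Omega> \<inter> S) x * q m t x"
        proof (cases "x \<in> \<Omega> \<inter> S")
          case True
          let ?i = "\<lambda>u. indicator {0<..<1} (m * (u x - t)) :: real"
          have d: "ramp_deriv r \<le> 2 * indicator {0<..<1} r" for r
            using ramp_deriv_bounds[of r] by (auto simp: indicator_def)
          have "\<bar>Gw m x \<bullet> \<phi> x\<bar> \<le> norm (Gw m x) * norm (\<phi> x)" by (rule Cauchy_Schwarz_ineq2)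
          also have "\<dots> \<le> norm (Gw m x)" using \<phi>1[of x] by (simp add: mult_left_le)
          also have "\<dots> \<le> (m * ramp_deriv (m * (u x - t))) * norm (Gu x) + (m * ramp_deriv (m * (v x - t))) * norm (Gv x)"
            unfolding Gw_def by (rule norm_triangle_le_diff) (use that ramp_deriv_bounds in auto)
          also have "\<dots> \<le> (m * (2 * ?i u)) * K + (m * (2 * ?i v)) * K"
            using that ramp_deriv_bounds Gu(2) Gv(2) d by (intro add_mono mult_mono) auto
          also have "\<dots> = 2 * K * (m * ?i u + m * ?i v)" by (simp add: algebra_simps)
          finally have "ennreal \<bar>Gw m x \<bullet> \<phi> x\<bar> \<le> ennreal (2 * K * (m * ?i u + m * ?i v))"
            by (rule ennreal_leI)
          also have "\<dots> = ennreal (2 * K) * indicator (\<Omega> \<inter> S) x * q m t x"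
            using True that K by (auto simp: q_def ennreal_mult ennreal_plus indicator_def)
          finally show ?thesis .
        next
          case False
          then have "Gw m x \<bullet> \<phi> x = 0"
            using S(2)[of x] \<phi>0[of x] by (auto simp: Gw_def)
          then show ?thesis by simp
        qed
      qed
      finally show ?thesis .
    qed
    have "ennreal \<bar>distributional_gradient \<Omega> (indicator {x \<in> \<Omega>. u x > t}) \<phi> -
        distributional_gradient \<Omega> (indicator {x \<in> \<Omega>. v x > t}) \<phi>\<bar> = liminf (\<lambda>m. ennreal \<bar>J (real (Suc m))\<bar>)"
      using lim_imp_Liminf[OF _ lim] by simp
    also have "\<dots> \<le> P t"
      unfolding P_def by (intro Liminf_mono always_eventually allI JQ) simp
    finally show "ennreal \<bar>distributional_gradient \<Omega> (indicator {x \<in> \<Omega>. u x > t}) \<phi> -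
        distributional_gradient \<Omega> (indicator {x \<in> \<Omega>. v x > t}) \<phi>\<bar> \<le> P t" .
  qed
qed

section \<open>Monotonicity, Sobolev and strict BV convergence\<close>

text \<open>A line in direction \<open>e\<close> through a point of \<open>V\<close> is connected
  and leaves the bounded set \<open>V\<close>, so it meets \<open>frontier V\<close>. Hence the two
  images coincide as sets, which settles suprema and infima together.\<close>

lemma lebesgue_monotone_if_invariant:
  fixes f :: "'a::euclidean_space \<Rightarrow> real"
  assumes "continuous_on \<Omega> f" "e \<noteq> 0" and inv: "\<And>x s. f (x + s *\<^sub>R e) = f x"
  shows "lebesgue_monotone \<Omega> f"
proof -
  have "f ` closure V = f ` frontier V" if "open V" "compact (closure V)" for V
  proof
    show "f ` closure V \<subseteq> f ` frontier V"
    proof (rule image_subsetI)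
      fix x assume x: "x \<in> closure V"
      let ?l = "range (\<lambda>s. x + s *\<^sub>R e)"
      have "?l \<inter> frontier V \<noteq> {}" if "x \<in> V"
      proof (rule connected_Int_frontier)
        show "connected ?l"
          by (intro connected_continuous_image continuous_intros) auto
        show "?l \<inter> V \<noteq> {}" using that by (auto intro!: exI[of _ x] rev_image_eqI[of 0])
        obtain B where B: "\<And>y. y \<in> closure V \<Longrightarrow> norm y \<le> B"
          using compact_imp_bounded[OF \<open>compact (closure V)\<close>] unfolding bounded_iff by blast
        let ?s = "(\<bar>B\<bar> + norm x + 1) / norm e"
        have "norm (?s *\<^sub>R e) = \<bar>B\<bar> + norm x + 1" using \<open>e \<noteq> 0\<close> by simp
        then have "norm (x + ?s *\<^sub>R e) > B"
          using norm_triangle_ineq4[of "x + ?s *\<^sub>R e" x] by simp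
        then have "x + ?s *\<^sub>R e \<notin> V" using B closure_subset by fastforce
        then show "?l - V \<noteq> {}" by blast
      qed
      then consider "x \<in> frontier V" | s where "x + s *\<^sub>R e \<in> frontier V"
        using x \<open>open V\<close> by (auto simp: frontier_def interior_open)
      then show "f x \<in> f ` frontier V"
        by cases (auto simp: inv intro!: rev_image_eqI[of "x + _ *\<^sub>R e"])
    qed
  qed (auto simp: frontier_def)
  then show ?thesis
    using assms(1) by (simp add: lebesgue_monotone_def)
qed

section \<open>Weak gradients of differentiable functions\<close>

lemma locally_integrable_on_bounded:
  fixes f :: "'a::euclidean_space \<Rightarrow> 'b::euclidean_space"
  assumes "f \<in> borel_measurable borel" "\<And>K. compact K \<Longrightarrow> \<exists>B. \<forall>x\<in>K. norm (f x) \<le> B"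
  shows "locally_integrable_on f \<Omega>"
  unfolding locally_integrable_on_def
proof (intro allI impI, elim conjE)
  fix K :: "'a set" assume "compact K"
  then obtain B where "\<And>x. x \<in> K \<Longrightarrow> norm (f x) \<le> B" using assms(2) by blast
  then show "set_integrable lebesgue K f"
    using \<open>compact K\<close> assms(1) by (intro set_integrable_lebesgue_bounded) (auto intro: compact_imp_bounded borel_compact)
qed

lemma weak_gradient_if_differentiable:
  fixes f :: "real ^ 'n::finite \<Rightarrow> real"
  assumes f: "\<And>x. (f has_derivative (\<lambda>v. G x \<bullet> v)) (at x)"
    and G: "G \<in> borel_measurable borel" "\<And>x. norm (G x) \<le> K" and \<Omega>: "open \<Omega>"
  shows "weak_gradient \<Omega> f G"
  unfolding weak_gradient_def
proof (intro conjI allI impI)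
  have fc: "continuous_on UNIV f"
    using f by (auto intro!: has_derivative_continuous_on intro: has_derivative_at_withinI)
  have [measurable]: "f \<in> borel_measurable borel" "G \<in> borel_measurable borel" "\<Omega> \<in> sets borel"
    using fc G \<Omega> by (auto intro: borel_measurable_continuous_onI)
  show "locally_integrable_on f \<Omega>"
  proof (rule locally_integrable_on_bounded)
    show "\<exists>B. \<forall>x\<in>C. norm (f x) \<le> B" if "compact C" for C
      using continuous_on_compact_norm_bound[OF fc that] by metis
  qed simp
  show "locally_integrable_on G \<Omega>"
    by (rule locally_integrable_on_bounded) (use G in auto)
  fix \<phi> :: "real ^ 'n \<Rightarrow> real" and i assume \<phi>: "test_function \<Omega> \<phi>"
  have [measurable]: "\<phi> \<in> borel_measurable borel" "partial_deriv i \<phi> \<in> borel_measurable borel"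
    using test_function_derivative(2,3)[OF \<phi>] by (auto intro: borel_measurable_continuous_onI)
  have [measurable]: "(\<lambda>x. G x $ i) \<in> borel_measurable borel"
    by (rule measurable_compose[OF G(1) borel_measurable_continuous_onI]) (intro continuous_intros)
  have z: "\<phi> x = 0 \<and> partial_deriv i \<phi> x = 0" if "x \<notin> \<Omega>" for x
    using test_function_bounds[OF \<phi>, of i] that by metis
  have "(LINT x:\<Omega>|lebesgue. f x * partial_deriv i \<phi> x) = (\<integral>x. f x * partial_deriv i \<phi> x \<partial>lborel)"
    by (rule set_integral_lebesgue_eq) (use z in auto)
  also have "\<dots> = - (\<integral>x. G x $ i * \<phi> x \<partial>lborel)"
    by (rule integral_by_parts_test_function(3)[OF f G \<phi>])
  also have "(\<integral>x. G x $ i * \<phi> x \<partial>lborel) = (LINT x:\<Omega>|lebesgue. G x $ i * \<phi> x)"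
    by (rule set_integral_lebesgue_eq[symmetric]) (use z in auto)
  finally show "(LINT x:\<Omega>|lebesgue. f x * partial_deriv i \<phi> x) = - (LINT x:\<Omega>|lebesgue. G x $ i * \<phi> x)" .
qed

section \<open>Comparison of total variations\<close>

lemma total_variation_le_add:
  fixes f g :: "real ^ 'n::finite \<Rightarrow> real"
  assumes "\<And>\<phi>. test_function \<Omega> \<phi> \<Longrightarrow> (\<And>x. norm (\<phi> x) \<le> 1) \<Longrightarrow>
      distributional_gradient \<Omega> f \<phi> \<le> distributional_gradient \<Omega> g \<phi> + d"
  shows "total_variation \<Omega> f \<le> total_variation \<Omega> g + ereal d"
  unfolding total_variation_def
proof (rule SUP_least)
  fix \<phi> :: "real ^ 'n \<Rightarrow> real ^ 'n" assume \<phi>: "\<phi> \<in> {\<phi>. test_function \<Omega> \<phi> \<and> (\<forall>x. norm (\<phi> x) \<le> 1)}"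
  then have "ereal (distributional_gradient \<Omega> f \<phi>) \<le> ereal (distributional_gradient \<Omega> g \<phi>) + ereal d"
    using assms by auto
  also have "\<dots> \<le> (SUP \<phi>\<in>{\<phi>. test_function \<Omega> \<phi> \<and> (\<forall>x. norm (\<phi> x) \<le> 1)}. ereal (distributional_gradient \<Omega> g \<phi>)) + ereal d"
    using \<phi> by (intro add_right_mono SUP_upper)
  finally show "ereal (distributional_gradient \<Omega> f \<phi>) \<le>
      (SUP \<phi>\<in>{\<phi>. test_function \<Omega> \<phi> \<and> (\<forall>x. norm (\<phi> x) \<le> 1)}. ereal (distributional_gradient \<Omega> g \<phi>)) + ereal d" .
qed

lemma total_variation_nonneg: "0 \<le> total_variation \<Omega> (f :: real ^ 'n::finite \<Rightarrow> real)"
proof -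
  have "smooth_on UNIV (\<lambda>x::real ^ 'n. 0 :: real ^ 'n)"
    by (simp add: smooth_on_def Ck_on_const)
  then have "(\<lambda>x::real ^ 'n. 0 :: real ^ 'n) \<in> {\<phi>. test_function \<Omega> \<phi> \<and> (\<forall>x. norm (\<phi> x) \<le> 1)}"
    by (simp add: test_function_def)
  moreover have "distributional_gradient \<Omega> f (\<lambda>x. 0) = 0"
    by (simp add: distributional_gradient_def divergence_def partial_deriv_def frechet_derivative_const set_lebesgue_integral_def)
  ultimately show ?thesis
    unfolding total_variation_def by (metis (mono_tags, lifting) SUP_upper zero_ereal_def)
qed

lemma total_variation_zero: "total_variation \<Omega> (\<lambda>x::real ^ 'n::finite. 0) = 0"
proof -
  have "distributional_gradient \<Omega> (\<lambda>x. 0) \<phi> = 0" for \<phi> :: "real ^ 'n \<Rightarrow> real ^ 'n"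
    by (simp add: distributional_gradient_def set_lebesgue_integral_def)
  then have "total_variation \<Omega> (\<lambda>x::real ^ 'n. 0) \<le> 0"
    by (auto simp: total_variation_def intro!: SUP_least)
  then show ?thesis using total_variation_nonneg by (intro antisym)
qed

text \<open>The sets \<open>S N\<close> carry the errors. \<open>S_lim\<close> turns every pointwise
  convergence into eventual equality, and \<open>S_sum\<close> gives convergence of perimeters for
  almost every \<open>t\<close> along the whole sequence. One constant \<open>K\<close> bounds
  gradients and values alike.\<close>

locale gradient_approximation =
  fixes \<Omega> :: "(real ^ 'n::finite) set" and us :: "nat \<Rightarrow> real ^ 'n \<Rightarrow> real" and u :: "real ^ 'n \<Rightarrow> real"
    and Gs :: "nat \<Rightarrow> real ^ 'n \<Rightarrow> real ^ 'n" and G :: "real ^ 'n \<Rightarrow> real ^ 'n" and K :: real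
    and S :: "nat \<Rightarrow> (real ^ 'n) set"
  assumes \<Omega>: "open \<Omega>" "bounded \<Omega>"
    and us: "(us N has_derivative (\<lambda>v. Gs N x \<bullet> v)) (at x)"
    and u: "(u has_derivative (\<lambda>v. G x \<bullet> v)) (at x)"
    and Gs: "Gs N \<in> borel_measurable borel" "norm (Gs N x) \<le> K"
    and G: "G \<in> borel_measurable borel" "norm (G x) \<le> K"
    and S: "S N \<in> sets borel" "x \<notin> S N \<Longrightarrow> us N x = u x \<and> Gs N x = G x"
    and S_lim: "eventually (\<lambda>N. x \<notin> S N) sequentially"
    and S_sum: "(\<Sum>N. emeasure lborel (\<Omega> \<inter> S N)) < \<infinity>"
    and us_bound: "x \<in> \<Omega> \<Longrightarrow> \<bar>us N x\<bar> \<le> K"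
begin

lemma measurable [measurable]:
  "us N \<in> borel_measurable borel" "u \<in> borel_measurable borel" "\<Omega> \<in> sets borel"
  "Gs N \<in> borel_measurable borel" "G \<in> borel_measurable borel"
proof -
  have "continuous_on UNIV (us N)" "continuous_on UNIV u"
    using us u by (auto intro!: has_derivative_continuous_on intro: has_derivative_at_withinI)
  then show "us N \<in> borel_measurable borel" "u \<in> borel_measurable borel"
    by (auto intro: borel_measurable_continuous_onI)
qed (use \<Omega> Gs G in auto)

lemma eventually_eq: "eventually (\<lambda>N. us N x = u x \<and> Gs N x = G x) sequentially"
  using S_lim[of x] by eventually_elim (rule S(2))

lemma u_bound: "x \<in> \<Omega> \<Longrightarrow> \<bar>u x\<bar> \<le> K"
  using eventually_happens'[OF sequentially_bot eventually_eq[of x]] us_bound[of x] by metis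

lemma W1p_tendsto:
  assumes p: "1 \<le> p"
  shows "W1p_tendsto p \<Omega> us u"
  unfolding W1p_tendsto_def
proof (intro exI conjI allI)
  note m = measurable(3) \<Omega>(2)
  show "in_Lp p \<Omega> (us N)" "in_Lp p \<Omega> (Gs N)" "in_Lp p \<Omega> u" "in_Lp p \<Omega> G" for N
    using p us_bound u_bound Gs(2) G(2) by (auto intro!: in_Lp_bounded[OF m])
  show "weak_gradient \<Omega> (us N) (Gs N)" for N
    by (rule weak_gradient_if_differentiable[OF us Gs \<Omega>(1)])
  show "weak_gradient \<Omega> u G"
    by (rule weak_gradient_if_differentiable[OF u G \<Omega>(1)])
  have "norm (us N x - u x) \<le> K + K" if "x \<in> \<Omega>" for N x
    using us_bound[OF that, of N] u_bound[OF that] by (intro norm_triangle_le_diff) simp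
  moreover have "(\<lambda>N. us N x - u x) \<longlonglongrightarrow> 0" for x
    by (rule tendsto_eventually) (use eventually_eq[of x] in eventually_elim, simp)
  ultimately show "(\<lambda>N. Lp_norm p \<Omega> (\<lambda>x. us N x - u x)) \<longlonglongrightarrow> 0"
    by (intro Lp_norm_tendsto_0[OF m _ _ _ p]) auto
  have "norm (Gs N x - G x) \<le> K + K" for N x
    using add_mono[OF Gs(2)[of N x] G(2)[of x]] by (rule norm_triangle_le_diff)
  moreover have "(\<lambda>N. Gs N x - G x) \<longlonglongrightarrow> 0" for x
    by (rule tendsto_eventually) (use eventually_eq[of x] in eventually_elim, simp)
  ultimately show "(\<lambda>N. Lp_norm p \<Omega> (\<lambda>x. Gs N x - G x)) \<longlonglongrightarrow> 0"
    by (intro Lp_norm_tendsto_0[OF m _ _ _ p]) auto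
qed

lemma K_nonneg: "0 \<le> K"
  using G(2)[of 0] norm_ge_zero order_trans by blast

lemma lipschitz_on_limit:
  assumes "convex \<Omega>"
  shows "K-lipschitz_on \<Omega> u"
proof (rule lipschitz_onI)
  fix x y assume xy: "x \<in> \<Omega>" "y \<in> \<Omega>"
  have "onorm (\<lambda>v. G z \<bullet> v) \<le> K" for z
  proof (rule onorm_bound[OF K_nonneg])
    show "norm (G z \<bullet> v) \<le> K * norm v" for v
      using Cauchy_Schwarz_ineq2[of "G z" v] mult_right_mono[OF G(2)[of z], of "norm v"] by simp
  qed
  then have "norm (u x - u y) \<le> K * norm (x - y)"
    by (intro differentiable_bound[OF assms, of u "\<lambda>z v. G z \<bullet> v"] xy) (auto intro: has_derivative_at_withinI u)
  then show "dist (u x) (u y) \<le> K * dist x y" by (simp add: dist_norm)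
qed (rule K_nonneg)

lemma superlevel_L1_tendsto:
  "(\<lambda>N. Lp_norm 1 \<Omega> (\<lambda>x. indicator {x \<in> \<Omega>. us N x > t} x - indicator {x \<in> \<Omega>. u x > t} x :: real)) \<longlonglongrightarrow> 0"
proof (rule Lp_norm_tendsto_0[where B = 1])
  show "(\<lambda>N. indicator {x \<in> \<Omega>. us N x > t} x - indicator {x \<in> \<Omega>. u x > t} x :: real) \<longlonglongrightarrow> 0" for x
    by (rule tendsto_eventually) (use eventually_eq[of x] in eventually_elim, simp add: indicator_def)
qed (use \<Omega> in \<open>auto simp: indicator_def\<close>)

text \<open>Comparison with the constant function \<open>c\<close>: for \<open>c \<le> t\<close> its
  superlevel set is empty, so the bound on the difference is a bound for \<open>u\<close> alone.
  Since \<Omega> has finite measure, \<open>P\<close> has finite integral and is finite almost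
  everywhere.\<close>

lemma total_variation_superlevel_finite:
  "AE t in lborel. c \<le> t \<longrightarrow> total_variation \<Omega> (indicator {x \<in> \<Omega>. u x > t}) < \<infinity>"
proof -
  have 0: "((\<lambda>_. c) has_derivative (\<lambda>w. 0 \<bullet> w)) (at x)" for x :: "real ^ 'n" by simp
  obtain P :: "real \<Rightarrow> ennreal" where P: "P \<in> borel_measurable borel"
    "(\<integral>\<^sup>+t. P t \<partial>lborel) \<le> ennreal (4 * K) * emeasure lborel (\<Omega> \<inter> UNIV)"
    "\<And>t \<phi>. test_function \<Omega> \<phi> \<Longrightarrow> (\<And>x. norm (\<phi> x) \<le> 1) \<Longrightarrow>
      ennreal \<bar>distributional_gradient \<Omega> (indicator {x \<in> \<Omega>. u x > t}) \<phi> -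
        distributional_gradient \<Omega> (indicator {x \<in> \<Omega>. c > t}) \<phi>\<bar> \<le> P t"
    by (rule superlevel_divergence_bound[OF u 0 G _ _ _ _ \<Omega>(1), of UNIV]) (use K_nonneg in auto)
  have "emeasure lborel (\<Omega> \<inter> UNIV) < \<infinity>"
    using emeasure_bounded_finite[OF \<Omega>(2)] by simp
  then have "(\<integral>\<^sup>+t. P t \<partial>lborel) < \<infinity>"
    using P(2) by (auto intro: le_less_trans simp: ennreal_mult_less_top)
  then have "AE t in lborel. P t \<noteq> \<infinity>"
    using P(1) by (intro nn_integral_PInf_AE) auto
  then show ?thesis
  proof eventually_elim
    fix t assume t: "P t \<noteq> \<infinity>"
    obtain d where d: "P t = ennreal d" "0 \<le> d" using t by (cases "P t") auto
    show "c \<le> t \<longrightarrow> total_variation \<Omega> (indicator {x \<in> \<Omega>. u x > t}) < \<infinity>"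
    proof
      assume "c \<le> t"
      then have 0: "indicator {x \<in> \<Omega>. t < c} = (\<lambda>x. 0 :: real)" by auto
      have "total_variation \<Omega> (indicator {x \<in> \<Omega>. u x > t}) \<le> total_variation \<Omega> (\<lambda>x. 0) + ereal d"
        by (rule total_variation_le_add) (use P(3)[of _ t] d in \<open>simp add: 0 abs_le_iff algebra_simps\<close>)
      then have "total_variation \<Omega> (indicator {x \<in> \<Omega>. u x > t}) \<le> ereal d"
        by (simp add: total_variation_zero)
      then show "total_variation \<Omega> (indicator {x \<in> \<Omega>. u x > t}) < \<infinity>"
        by (rule le_less_trans) simp
    qed
  qed
qed

text \<open>An argument of Borel-Cantelli type: the integrals of \<open>P N\<close> are summable
  over \<open>N\<close>, so for almost every \<open>t\<close> the numbers \<open>P N t\<close> are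
  summable and tend to 0. Finiteness for \<open>u\<close> is a premise so that the two-sided
  estimate can be read in the reals.\<close>

lemma total_variation_superlevel_tendsto:
  "AE t in lborel. total_variation \<Omega> (indicator {x \<in> \<Omega>. u x > t}) < \<infinity> \<longrightarrow>
    (\<forall>N. total_variation \<Omega> (indicator {x \<in> \<Omega>. us N x > t}) < \<infinity>) \<and>
    (\<lambda>N. total_variation \<Omega> (indicator {x \<in> \<Omega>. us N x > t})) \<longlonglongrightarrow> total_variation \<Omega> (indicator {x \<in> \<Omega>. u x > t})"
proof -
  define bound where "bound N P \<longleftrightarrow> P \<in> borel_measurable borel \<and>
    (\<integral>\<^sup>+t. P t \<partial>lborel) \<le> ennreal (4 * K) * emeasure lborel (\<Omega> \<inter> S N) \<and>
    (\<forall>t \<phi>. test_function \<Omega> \<phi> \<longrightarrow> (\<forall>x. norm (\<phi> x) \<le> 1) \<longrightarrow>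
      ennreal \<bar>distributional_gradient \<Omega> (indicator {x \<in> \<Omega>. us N x > t}) \<phi> -
        distributional_gradient \<Omega> (indicator {x \<in> \<Omega>. u x > t}) \<phi>\<bar> \<le> P t)" for N and P :: "real \<Rightarrow> ennreal"
  have "\<exists>P. bound N P" for N
  proof (rule superlevel_divergence_bound[OF us u Gs G S(1) _ \<Omega>(1)])
    show "x \<notin> S N \<Longrightarrow> us N x = u x \<and> Gs N x = G x" for x by (rule S(2))
  qed (unfold bound_def, blast)
  then obtain P where "\<And>N. bound N (P N)" by metis
  then have P: "\<And>N. P N \<in> borel_measurable borel"
    "\<And>N. (\<integral>\<^sup>+t. P N t \<partial>lborel) \<le> ennreal (4 * K) * emeasure lborel (\<Omega> \<inter> S N)"
    "\<And>N t \<phi>. test_function \<Omega> \<phi> \<Longrightarrow> (\<forall>x. norm (\<phi> x) \<le> 1) \<Longrightarrow>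
      ennreal \<bar>distributional_gradient \<Omega> (indicator {x \<in> \<Omega>. us N x > t}) \<phi> -
        distributional_gradient \<Omega> (indicator {x \<in> \<Omega>. u x > t}) \<phi>\<bar> \<le> P N t"
    unfolding bound_def by blast+
  have "(\<integral>\<^sup>+t. (\<Sum>N. P N t) \<partial>lborel) = (\<Sum>N. \<integral>\<^sup>+t. P N t \<partial>lborel)"
    using P(1) by (intro nn_integral_suminf) auto
  also have "\<dots> \<le> (\<Sum>N. ennreal (4 * K) * emeasure lborel (\<Omega> \<inter> S N))"
    by (intro suminf_le P(2)) auto
  also have "\<dots> < \<infinity>"
    using S_sum by (simp add: ennreal_mult_less_top)
  finally have "AE t in lborel. (\<Sum>N. P N t) \<noteq> \<infinity>"
    using P(1) by (intro nn_integral_PInf_AE) auto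
  then show ?thesis
  proof (eventually_elim, intro impI)
    fix t assume t: "(\<Sum>N. P N t) \<noteq> \<infinity>"
      and fin: "total_variation \<Omega> (indicator {x \<in> \<Omega>. u x > t}) < \<infinity>"
    have "P N t < \<infinity>" for N
      by (rule ennreal_suminf_lessD[of "\<lambda>N. P N t"]) (use t in \<open>simp add: less_top\<close>)
    define d where "d N = enn2real (P N t)" for N
    have d: "P N t = ennreal (d N)" "0 \<le> d N" for N
      using \<open>P N t < \<infinity>\<close> by (auto simp: d_def)
    have "summable d"
      by (rule summable_suminf_not_top) (use d t in auto)
    then have d0: "d \<longlonglongrightarrow> 0" by (rule summable_LIMSEQ_zero)
    let ?T = "\<lambda>N. total_variation \<Omega> (indicator {x \<in> \<Omega>. us N x > t})"
    obtain r where r: "total_variation \<Omega> (indicator {x \<in> \<Omega>. u x > t}) = ereal r"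
      using fin total_variation_nonneg[of \<Omega> "indicator {x \<in> \<Omega>. u x > t}"]
      by (cases "total_variation \<Omega> (indicator {x \<in> \<Omega>. u x > t})") auto
    have P': "\<bar>distributional_gradient \<Omega> (indicator {x \<in> \<Omega>. us N x > t}) \<phi> -
        distributional_gradient \<Omega> (indicator {x \<in> \<Omega>. u x > t}) \<phi>\<bar> \<le> d N"
      if "test_function \<Omega> \<phi>" "\<And>x. norm (\<phi> x) \<le> 1" for \<phi> N
      using P(3)[of \<phi> t N] that d[of N] by simp
    have up: "?T N \<le> ereal r + ereal (d N)" for N
      unfolding r[symmetric]
    proof (rule total_variation_le_add)
      fix \<phi> :: "real ^ 'n \<Rightarrow> real ^ 'n" assume "test_function \<Omega> \<phi>" "\<And>x. norm (\<phi> x) \<le> 1"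
      from P'[OF this, of N] show "distributional_gradient \<Omega> (indicator {x \<in> \<Omega>. us N x > t}) \<phi>
          \<le> distributional_gradient \<Omega> (indicator {x \<in> \<Omega>. u x > t}) \<phi> + d N"
        by linarith
    qed
    have lo: "ereal r \<le> ?T N + ereal (d N)" for N
      unfolding r[symmetric]
    proof (rule total_variation_le_add)
      fix \<phi> :: "real ^ 'n \<Rightarrow> real ^ 'n" assume "test_function \<Omega> \<phi>" "\<And>x. norm (\<phi> x) \<le> 1"
      from P'[OF this, of N] show "distributional_gradient \<Omega> (indicator {x \<in> \<Omega>. u x > t}) \<phi>
          \<le> distributional_gradient \<Omega> (indicator {x \<in> \<Omega>. us N x > t}) \<phi> + d N"
        by linarith
    qed
    have lim: "(\<lambda>N. ereal (r - d N)) \<longlonglongrightarrow> ereal r" "(\<lambda>N. ereal (r + d N)) \<longlonglongrightarrow> ereal r"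
      using tendsto_diff[OF tendsto_const d0, of r] tendsto_add[OF tendsto_const d0, of r] by auto
    have sandwich: "ereal (r - d N) \<le> ?T N" "?T N \<le> ereal (r + d N)" for N
      using up[of N] lo[of N] by (cases "?T N"; simp)+
    have "?T \<longlonglongrightarrow> ereal r"
      by (rule tendsto_sandwich[OF always_eventually[OF allI[OF sandwich(1)]]
            always_eventually[OF allI[OF sandwich(2)]] lim])
    moreover have "?T N < \<infinity>" for N
      using sandwich(2)[of N] by (rule le_less_trans) simp
    ultimately show "(\<forall>N. ?T N < \<infinity>) \<and> ?T \<longlonglongrightarrow> total_variation \<Omega> (indicator {x \<in> \<Omega>. u x > t})"
      by (simp add: r)
  qed
qed

lemma strict_BV_tendsto_superlevel:
  "AE t in lebesgue. c \<le> t \<longrightarrow>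
    strict_BV_tendsto \<Omega> (\<lambda>N. indicator {x \<in> \<Omega>. us N x > t}) (indicator {x \<in> \<Omega>. u x > t})"
proof (rule AE_completion)
  have Lp: "in_Lp 1 \<Omega> (indicator {x \<in> \<Omega>. f x > t} :: real ^ 'n \<Rightarrow> real)"
    if [measurable]: "f \<in> borel_measurable borel" for f :: "real ^ 'n \<Rightarrow> real" and t
    by (rule in_Lp_bounded[where B = 1]) (use \<Omega>(2) in \<open>auto simp: indicator_def\<close>)
  show "AE t in lborel. c \<le> t \<longrightarrow>
    strict_BV_tendsto \<Omega> (\<lambda>N. indicator {x \<in> \<Omega>. us N x > t}) (indicator {x \<in> \<Omega>. u x > t})"
    using total_variation_superlevel_finite[of c] total_variation_superlevel_tendsto
    by eventually_elim (simp add: strict_BV_tendsto_def in_BV_def Lp superlevel_L1_tendsto)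
qed

end

section \<open>Ripples\<close>

text \<open>At the midpoint each flat factor is exp(-2), so \<open>exp 4\<close> normalises the peak
  to 1.\<close>

definition bump :: "real \<Rightarrow> real" where
  "bump w = exp 4 * (flat_exp 1 w * flat_exp 1 (1 - w))"

definition bump_deriv :: "real \<Rightarrow> real" where
  "bump_deriv w = exp 4 * (flat_exp (monom 1 2) w * flat_exp 1 (1 - w) - flat_exp 1 w * flat_exp (monom 1 2) (1 - w))"

lemma bump_has_derivative: "(bump has_real_derivative bump_deriv w) (at w)"
proof -
  have 1: "(flat_exp 1 has_real_derivative flat_exp (monom 1 2) w) (at w)" for w
    using flat_exp_has_derivative[of 1 w] by simp
  have 2: "((\<lambda>w. flat_exp 1 (1 - w)) has_real_derivative - flat_exp (monom 1 2) (1 - w)) (at w)"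
  proof -
    have "((\<lambda>w. 1 - w) has_real_derivative - 1) (at w)" by (auto intro!: derivative_eq_intros)
    from DERIV_chain2[OF 1 this] show ?thesis by simp
  qed
  show ?thesis
    unfolding bump_def[abs_def] bump_deriv_def
    using DERIV_cmult[OF DERIV_mult[OF 1 2], of "exp 4"] by (simp add: algebra_simps)
qed

lemma smooth_on_bump: "smooth_on UNIV bump"
  unfolding smooth_on_def
proof
  fix k
  have f: "Ck_on k UNIV (flat_exp 1)"
    using smooth_on_flat_exp by (simp add: smooth_on_def)
  have l: "Ck_on k UNIV (\<lambda>w::real. 1 + - w)"
    by (intro Ck_on_add Ck_on_const Ck_on_linear bounded_linear_minus bounded_linear_ident open_UNIV)
  have "Ck_on k UNIV (\<lambda>w. flat_exp 1 (1 - w))"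
    using Ck_on_compose[OF open_UNIV _ f l] by simp
  then show "Ck_on k UNIV bump"
    unfolding bump_def[abs_def] by (intro Ck_on_mult Ck_on_const f open_UNIV)
qed

lemma continuous_on_bump: "continuous_on UNIV bump" "continuous_on UNIV bump_deriv"
proof -
  have f: "continuous_on UNIV (flat_exp p)" for p
    using smooth_on_flat_exp[of p] by (metis smooth_on_def Ck_on.simps(1))
  have g: "continuous_on UNIV (\<lambda>w. flat_exp p (1 - w))" for p
    by (rule continuous_on_compose2[OF f]) (auto intro!: continuous_intros)
  show "continuous_on UNIV bump" "continuous_on UNIV bump_deriv"
    unfolding bump_def[abs_def] bump_deriv_def[abs_def] by (intro continuous_intros f g)+
qed

lemma bump_outside: "w \<notin> {0<..<1} \<Longrightarrow> bump w = 0 \<and> bump_deriv w = 0"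
  by (auto simp: bump_def bump_deriv_def flat_exp_def)

lemma bump_half: "bump (1/2) = 1"
  by (simp add: bump_def flat_exp_def flip: exp_add)

text \<open>The logarithmic derivative of \<open>bump\<close> is 1/w^2 - 1/(1-w)^2. Having a single
  interior critical point is what makes the critical values of the partial sums explicit.\<close>

lemma bump_deriv_eq_0:
  assumes "0 < w" "w < 1" "bump_deriv w = 0"
  shows "w = 1/2"
proof -
  have "flat_exp (monom 1 2) w * flat_exp 1 (1 - w) = flat_exp 1 w * flat_exp (monom 1 2) (1 - w)"
    using assms by (simp add: bump_deriv_def)
  then have "(inverse w)\<^sup>2 = (inverse (1 - w))\<^sup>2"
    using assms by (simp add: flat_exp_def poly_monom)
  then have "inverse w = inverse (1 - w)"
    by (rule power2_eq_imp_eq) (use assms in auto)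
  then show ?thesis by simp
qed

lemma bump_bounded:
  obtains M where "\<And>w. \<bar>bump w\<bar> \<le> M" "\<And>w. \<bar>bump_deriv w\<bar> \<le> M"
proof -
  obtain B where B: "\<And>w. w \<in> {0..1} \<Longrightarrow> \<bar>bump w\<bar> \<le> B"
    using continuous_on_compact_norm_bound[OF continuous_on_bump(1) compact_Icc] by (metis real_norm_def)
  obtain B' where B': "\<And>w. w \<in> {0..1} \<Longrightarrow> \<bar>bump_deriv w\<bar> \<le> B'"
    using continuous_on_compact_norm_bound[OF continuous_on_bump(2) compact_Icc] by (metis real_norm_def)
  have M: "\<bar>bump w\<bar> \<le> max 0 (max B B') \<and> \<bar>bump_deriv w\<bar> \<le> max 0 (max B B')" for w
    using B[of w] B'[of w] bump_outside[of w] by (cases "w \<in> {0..1}") (auto simp: le_max_iff_disj)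
  show thesis by (rule that) (use M in blast)+
qed

text \<open>The \<open>k\<close>-th ripple lives in the strip \<open>2^-(k+1) < y < 2^-k\<close>. Its amplitude \<open>10 / 4^k\<close> is quadratic in
  the distance to \<open>y = 0\<close>, so that the sum of all ripples is differentiable there; it exceeds the
  wavelength enough to create closed level curves at every height.\<close>

definition ripple :: "nat \<Rightarrow> real \<Rightarrow> real \<Rightarrow> real" where
  "ripple k y z = 10 / 4 ^ k * (bump (2 ^ Suc k * y - 1) * sin (4 ^ k * z))"

definition ripple_dy :: "nat \<Rightarrow> real \<Rightarrow> real \<Rightarrow> real" where
  "ripple_dy k y z = 10 / 4 ^ k * (2 ^ Suc k * bump_deriv (2 ^ Suc k * y - 1) * sin (4 ^ k * z))"

definition ripple_dz :: "nat \<Rightarrow> real \<Rightarrow> real \<Rightarrow> real" where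
  "ripple_dz k y z = 10 * (bump (2 ^ Suc k * y - 1) * cos (4 ^ k * z))"

definition strip :: "nat \<Rightarrow> real set" where
  "strip k = {y. 1 < 2 ^ Suc k * y \<and> 2 ^ Suc k * y < 2}"

lemma ripple_outside:
  "y \<notin> strip k \<Longrightarrow> ripple k y z = 0 \<and> ripple_dy k y z = 0 \<and> ripple_dz k y z = 0"
  using bump_outside[of "2 ^ Suc k * y - 1"]
  by (auto simp: strip_def ripple_def ripple_dy_def ripple_dz_def)

lemma strip_pos: "y \<in> strip k \<Longrightarrow> 0 < y"
proof -
  assume "y \<in> strip k"
  then have "1 < 2 ^ Suc k * y" by (simp add: strip_def del: power_Suc)
  then have "0 < 2 ^ Suc k * y" by linarith
  then show "0 < y" by (rule zero_less_mult_pos) simp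
qed

lemma strip_less:
  assumes "y \<in> strip j" "j < k"
  shows "2 < 2 ^ Suc k * y"
proof -
  have y: "0 < y" "1 < 2 ^ Suc j * y"
    using assms(1) strip_pos by (auto simp: strip_def)
  have "2 * (2 ^ Suc j * y) = 2 ^ Suc (Suc j) * y" by simp
  also have "\<dots> \<le> 2 ^ Suc k * y"
    using assms(2) y by (intro mult_right_mono power_increasing) auto
  finally show ?thesis using y(2) by linarith
qed

text \<open>If \<open>y\<close> lies in no strip, \<open>k\<close> is arbitrary; this form collapses
  sums over ripples to one term without a case distinction.\<close>

lemma strip_unique:
  obtains k where "\<And>j. j \<noteq> k \<Longrightarrow> y \<notin> strip j"
proof (cases "\<exists>k. y \<in> strip k")
  case True
  then obtain k where k: "y \<in> strip k" by blast
  have "y \<notin> strip j" if "j \<noteq> k" for j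
    using that k strip_less[of y j k] strip_less[of y k j] by (auto simp: strip_def neq_iff)
  then show thesis by (rule that)
qed (use that in blast)

lemma strip_less_inverse_power:
  assumes "y \<in> strip k" "N \<le> k"
  shows "0 < y" "y < 1 / 2 ^ N"
proof -
  show y: "0 < y" using assms(1) by (rule strip_pos)
  have "2 ^ N * y \<le> 2 ^ k * y"
    using assms(2) y by (intro mult_right_mono power_increasing) auto
  also have "\<dots> < 1" using assms(1) by (simp add: strip_def)
  finally show "y < 1 / 2 ^ N" by (simp add: field_simps)
qed

lemma sum_single_strip:
  fixes f :: "nat \<Rightarrow> 'a::real_normed_vector"
  assumes "\<And>j. j \<noteq> k \<Longrightarrow> f j = 0"
  shows "(\<Sum>j<N. f j) = (if k < N then f k else 0)" "(\<Sum>j. f j) = f k"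
proof -
  have "(\<Sum>j<N. f j) = (\<Sum>j<N. if j = k then f k else 0)"
    using assms by (intro sum.cong) auto
  then show "(\<Sum>j<N. f j) = (if k < N then f k else 0)" by simp
  show "(\<Sum>j. f j) = f k"
    using suminf_finite[of "{k}" f] assms by simp
qed

lemma ripple_has_derivative:
  fixes x :: "real ^ 'n::finite"
  shows "((\<lambda>x. ripple k (x $ a) (x $ b)) has_derivative
    (\<lambda>v. ripple_dy k (x $ a) (x $ b) * v $ a + ripple_dz k (x $ a) (x $ b) * v $ b)) (at x)"
proof -
  let ?c = "2 ^ Suc k :: real" and ?d = "4 ^ k :: real"
  have l: "((\<lambda>x. x $ i) has_derivative (\<lambda>v. v $ i)) (at x)" for i
    by (rule bounded_linear_imp_has_derivative[OF bounded_linear_vec_nth])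
  have A: "((\<lambda>x. ?c * x $ a - 1) has_derivative (\<lambda>v. ?c * v $ a)) (at x)"
    by (auto intro!: derivative_eq_intros l)
  have B: "((\<lambda>x. ?d * x $ b) has_derivative (\<lambda>v. ?d * v $ b)) (at x)"
    by (auto intro!: derivative_eq_intros l)
  have A': "((\<lambda>x. bump (?c * x $ a - 1)) has_derivative (\<lambda>v. bump_deriv (?c * x $ a - 1) * (?c * v $ a))) (at x)"
    using diff_chain_at[OF A bump_has_derivative[unfolded has_field_derivative_def]] by (simp add: o_def)
  have B': "((\<lambda>x. sin (?d * x $ b)) has_derivative (\<lambda>v. cos (?d * x $ b) * (?d * v $ b))) (at x)"
    using diff_chain_at[OF B DERIV_sin[unfolded has_field_derivative_def]] by (simp add: o_def)
  show ?thesis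
    unfolding ripple_def ripple_dy_def ripple_dz_def
    by (rule has_derivative_eq_rhs[OF has_derivative_mult_right[OF has_derivative_mult[OF A' B']]])
      (simp add: fun_eq_iff field_simps)
qed

lemma ripple_smooth:
  "smooth_on S (\<lambda>x::real ^ 'n::finite. ripple k (x $ a) (x $ b))"
  unfolding smooth_on_def
proof
  fix m
  have l: "Ck_on m UNIV (\<lambda>x::real ^ 'n. c * x $ i + d)" for c d i
    by (intro Ck_on_add Ck_on_mult Ck_on_const Ck_on_linear bounded_linear_vec_nth open_UNIV)
  have b: "Ck_on m UNIV (\<lambda>x::real ^ 'n. bump (c * x $ i + d))" for c d i
    using Ck_on_compose[OF open_UNIV _ _ l, where f = bump and T = UNIV] smooth_on_bump by (simp add: smooth_on_def)
  have s: "Ck_on m UNIV (\<lambda>x::real ^ 'n. sin (c * x $ i + d))" for c d i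
    using Ck_on_compose[OF open_UNIV _ _ l, where f = sin and T = UNIV] smooth_on_sin by (simp add: smooth_on_def)
  have c: "Ck_on m UNIV (\<lambda>x::real ^ 'n. 10 / 4 ^ k * (bump (2 ^ Suc k * x $ a + - 1) * sin (4 ^ k * x $ b + 0)))"
    by (intro Ck_on_mult Ck_on_const b s open_UNIV)
  show "Ck_on m S (\<lambda>x. ripple k (x $ a) (x $ b))"
    using Ck_on_subset[OF c subset_UNIV] by (simp add: ripple_def)
qed

lemma ripple_bounded:
  obtains M where "0 \<le> M" "\<And>k y z. \<bar>ripple k y z\<bar> \<le> M / 4 ^ k" "\<And>k y z. \<bar>ripple k y z\<bar> \<le> M * y\<^sup>2"
    "\<And>k y z. \<bar>ripple_dy k y z\<bar> \<le> M" "\<And>k y z. \<bar>ripple_dz k y z\<bar> \<le> M"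
proof -
  obtain B where B: "\<And>w. \<bar>bump w\<bar> \<le> B" "\<And>w. \<bar>bump_deriv w\<bar> \<le> B"
    using bump_bounded by metis
  have B0: "0 \<le> B" using B(1)[of 0] by simp
  have bs: "\<bar>bump w * s\<bar> \<le> B" "\<bar>bump_deriv w * s\<bar> \<le> B" if "\<bar>s\<bar> \<le> 1" for w s
    using mult_mono[OF B(1)[of w] that B0] mult_mono[OF B(2)[of w] that B0] by (auto simp: abs_mult)
  have r: "\<bar>ripple k y z\<bar> \<le> 10 * B / 4 ^ k" for k y z
  proof -
    have "\<bar>ripple k y z\<bar> = 10 / 4 ^ k * \<bar>bump (2 ^ Suc k * y - 1) * sin (4 ^ k * z)\<bar>"
      by (simp add: ripple_def abs_mult)
    also have "\<dots> \<le> 10 / 4 ^ k * B" by (intro mult_left_mono bs) auto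
    finally show ?thesis by simp
  qed
  show thesis
  \<comment> \<open>The 40 is 10 times 4, where 4 comes from 4^-k \<le> 4 * y^2 on the strip; the
    other bounds already hold with 20 * B.\<close>
  proof (rule that[of "40 * B"])
    show "0 \<le> 40 * B" using B0 by simp
    fix k y z
    show "\<bar>ripple k y z\<bar> \<le> 40 * B / 4 ^ k"
      by (rule order_trans[OF r]) (use B0 in \<open>auto intro!: divide_right_mono\<close>)
    show "\<bar>ripple k y z\<bar> \<le> 40 * B * y\<^sup>2"
    proof (cases "y \<in> strip k")
      case True
      then have "1 \<le> (2 ^ Suc k * y)\<^sup>2" by (intro one_le_power) (simp add: strip_def)
      also have "\<dots> = 4 * 4 ^ k * y\<^sup>2"
        by (simp add: power_mult_distrib power2_eq_square flip: power_mult_distrib)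
      finally have "1 / 4 ^ k \<le> 4 * y\<^sup>2" by (simp add: field_simps)
      then have "10 * B * (1 / 4 ^ k) \<le> 10 * B * (4 * y\<^sup>2)" using B0 by (intro mult_left_mono) auto
      then show ?thesis using r[of k y z] by simp
    qed (use ripple_outside B0 in simp)
    have "(10 * 2 ^ Suc k) / 4 ^ k \<le> (40 :: real)"
    proof -
      have "(2::real) ^ k \<le> 4 ^ k" by (rule power_mono) auto
      then have "(2::real) ^ k / 4 ^ k \<le> 1" by simp
      moreover have "(10 * 2 ^ Suc k) / 4 ^ k = 20 * ((2::real) ^ k / 4 ^ k)" by simp
      ultimately show ?thesis by linarith
    qed
    have "\<bar>ripple_dy k y z\<bar> = (10 * 2 ^ Suc k) / 4 ^ k * \<bar>bump_deriv (2 ^ Suc k * y - 1) * sin (4 ^ k * z)\<bar>"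
      by (simp add: ripple_dy_def abs_mult)
    also have "\<dots> \<le> 40 * B"
      using \<open>(10 * 2 ^ Suc k) / 4 ^ k \<le> (40 :: real)\<close> by (intro mult_mono bs) auto
    finally show "\<bar>ripple_dy k y z\<bar> \<le> 40 * B" .
    have "\<bar>ripple_dz k y z\<bar> = 10 * \<bar>bump (2 ^ Suc k * y - 1) * cos (4 ^ k * z)\<bar>"
      by (simp add: ripple_dz_def abs_mult)
    also have "\<dots> \<le> 40 * B" using B0 by (intro mult_mono bs) auto
    finally show "\<bar>ripple_dz k y z\<bar> \<le> 40 * B" .
  qed
qed

section \<open>The rippled height functions\<close>

definition rippled :: "nat \<Rightarrow> 'n \<Rightarrow> 'n \<Rightarrow> real ^ 'n::finite \<Rightarrow> real" where
  "rippled N a b x = x $ b + (\<Sum>k<N. ripple k (x $ a) (x $ b))"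

definition rippled_lim :: "'n \<Rightarrow> 'n \<Rightarrow> real ^ 'n::finite \<Rightarrow> real" where
  "rippled_lim a b x = x $ b + (\<Sum>k. ripple k (x $ a) (x $ b))"

definition rippled_grad :: "nat \<Rightarrow> 'n \<Rightarrow> 'n \<Rightarrow> real ^ 'n::finite \<Rightarrow> real ^ 'n" where
  "rippled_grad N a b x = (\<Sum>k<N. ripple_dy k (x $ a) (x $ b)) *\<^sub>R axis a 1 +
    (1 + (\<Sum>k<N. ripple_dz k (x $ a) (x $ b))) *\<^sub>R axis b 1"

definition rippled_lim_grad :: "'n \<Rightarrow> 'n \<Rightarrow> real ^ 'n::finite \<Rightarrow> real ^ 'n" where
  "rippled_lim_grad a b x = (\<Sum>k. ripple_dy k (x $ a) (x $ b)) *\<^sub>R axis a 1 +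
    (1 + (\<Sum>k. ripple_dz k (x $ a) (x $ b))) *\<^sub>R axis b 1"

lemma rippled_eq_lim:
  assumes "\<not> (0 < x $ a \<and> x $ a < 1 / 2 ^ N)"
  shows "rippled N a b x = rippled_lim a b x" "rippled_grad N a b x = rippled_lim_grad a b x"
proof -
  have "x $ a \<notin> strip k" if "k \<notin> {..<N}" for k
    using assms strip_less_inverse_power[of "x $ a" k N] that by auto
  then have "ripple k (x $ a) z = 0 \<and> ripple_dy k (x $ a) z = 0 \<and> ripple_dz k (x $ a) z = 0" if "k \<notin> {..<N}" for k z
    using that ripple_outside by blast
  then have "(\<Sum>k. ripple k (x $ a) (x $ b)) = (\<Sum>k<N. ripple k (x $ a) (x $ b))"
    "(\<Sum>k. ripple_dy k (x $ a) (x $ b)) = (\<Sum>k<N. ripple_dy k (x $ a) (x $ b))"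
    "(\<Sum>k. ripple_dz k (x $ a) (x $ b)) = (\<Sum>k<N. ripple_dz k (x $ a) (x $ b))"
    by (intro suminf_finite; simp)+
  then show "rippled N a b x = rippled_lim a b x" "rippled_grad N a b x = rippled_lim_grad a b x"
    by (simp_all add: rippled_def rippled_lim_def rippled_grad_def rippled_lim_grad_def)
qed

text \<open>At most one ripple is alive at a point. The index \<open>k\<close> depends on
  \<open>x\<close> but not on \<open>N\<close>, so the partial sums and the limit can be compared
  through the same ripple.\<close>

lemma rippled_single:
  obtains k where "\<And>N. rippled N a b x = x $ b + (if k < N then ripple k (x $ a) (x $ b) else 0)"
    "rippled_lim a b x = x $ b + ripple k (x $ a) (x $ b)"
    "\<And>N. rippled_grad N a b x = (if k < N then ripple_dy k (x $ a) (x $ b) else 0) *\<^sub>R axis a 1 +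
      (1 + (if k < N then ripple_dz k (x $ a) (x $ b) else 0)) *\<^sub>R axis b 1"
    "rippled_lim_grad a b x = ripple_dy k (x $ a) (x $ b) *\<^sub>R axis a 1 +
      (1 + ripple_dz k (x $ a) (x $ b)) *\<^sub>R axis b 1"
proof -
  obtain k where k: "\<And>j. j \<noteq> k \<Longrightarrow> x $ a \<notin> strip j" using strip_unique[of "x $ a"] by blast
  have "ripple j (x $ a) (x $ b) = 0" "ripple_dy j (x $ a) (x $ b) = 0" "ripple_dz j (x $ a) (x $ b) = 0" if "j \<noteq> k" for j
    using ripple_outside[OF k[OF that]] by auto
  note s = this[THEN sum_single_strip(1)] this[THEN sum_single_strip(2)]
  show thesis
    by (rule that[of k]) (simp_all only: rippled_def rippled_lim_def rippled_grad_def rippled_lim_grad_def s)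
qed

lemma rippled_has_derivative:
  "(rippled N a b has_derivative (\<lambda>v. rippled_grad N a b x \<bullet> v)) (at x)"
proof -
  have "((\<lambda>x. x $ b + (\<Sum>k<N. ripple k (x $ a) (x $ b))) has_derivative
    (\<lambda>v. v $ b + (\<Sum>k<N. ripple_dy k (x $ a) (x $ b) * v $ a + ripple_dz k (x $ a) (x $ b) * v $ b))) (at x)"
    by (intro has_derivative_add has_derivative_sum ripple_has_derivative
        bounded_linear_imp_has_derivative bounded_linear_vec_nth)
  then show ?thesis
    unfolding rippled_def[abs_def]
    by (rule has_derivative_eq_rhs)
      (simp add: fun_eq_iff rippled_grad_def inner_add_left inner_axis' sum.distrib sum_distrib_left algebra_simps)
qed

text \<open>Away from \<open>x $ a = 0\<close> the limit agrees locally with a partial sum; at \<open>x $ a = 0\<close> it differs from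
  \<open>x $ b\<close> by at most a multiple of \<open>(x $ a)\<^sup>2\<close>.\<close>

lemma rippled_lim_has_derivative:
  fixes x :: "real ^ 'n::finite"
  shows "(rippled_lim a b has_derivative (\<lambda>v. rippled_lim_grad a b x \<bullet> v)) (at x)"
proof (cases "x $ a = 0")
  case False
  \<comment> \<open>The closed slab is avoided, so that agreement with one partial sum holds on an
    open neighbourhood of \<open>x\<close>.\<close>
  have "\<exists>N. \<not> (0 \<le> x $ a \<and> x $ a \<le> 1 / 2 ^ N)"
  proof (cases "0 < x $ a")
    case True
    obtain N where "(1/2) ^ N < x $ a"
      using real_arch_pow_inv[OF True, of "1/2"] by auto
    then show ?thesis by (auto simp: power_divide not_le intro!: exI[of _ N])
  qed (use False in auto)
  then obtain N where N: "\<not> (0 \<le> x $ a \<and> x $ a \<le> 1 / 2 ^ N)" by blast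
  let ?V = "{x :: real ^ 'n. x $ a < 0} \<union> {x. x $ a > 1 / 2 ^ N}"
  have V: "open ?V" "x \<in> ?V"
    using N by (auto intro!: open_Un open_Collect_less continuous_intros)
  have eq: "rippled N a b y = rippled_lim a b y" "rippled_grad N a b y = rippled_lim_grad a b y" if "y \<in> ?V" for y
    using that by (auto intro!: rippled_eq_lim)
  have "(rippled N a b has_derivative (\<lambda>v. rippled_lim_grad a b x \<bullet> v)) (at x)"
    using rippled_has_derivative[of N a b x] unfolding eq(2)[OF V(2)] .
  then show ?thesis
    by (rule has_derivative_transform_within_open[OF _ V eq(1)])
next
  case True
  obtain M where M: "0 \<le> M" "\<And>k y z. \<bar>ripple k y z\<bar> \<le> M * y\<^sup>2"
    using ripple_bounded by metis
  \<comment> \<open>For \<open>N = 0\<close> the partial sum is the bare coordinate, and points with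
    \<open>x $ a = 0\<close> lie outside every slab.\<close>
  have grad: "rippled_lim_grad a b x = axis b 1"
    using rippled_eq_lim(2)[of x a 0 b] True by (simp add: rippled_grad_def)
  let ?F = "\<lambda>x::real ^ 'n. rippled_lim a b x - x $ b"
  have F: "\<bar>?F y\<bar> \<le> M * (norm (y - x))\<^sup>2" for y
  proof -
    obtain k where "rippled_lim a b y = y $ b + ripple k (y $ a) (y $ b)"
      by (rule rippled_single[of a b y], rule that; blast)
    then have "\<bar>?F y\<bar> \<le> M * (y $ a)\<^sup>2" using M(2) by simp
    also have "(y $ a)\<^sup>2 \<le> (norm (y - x))\<^sup>2"
      using component_le_norm_cart[of "y - x" a] True by (simp add: abs_le_square_iff[symmetric])
    finally show ?thesis using M(1) by (simp add: mult_left_mono)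
  qed
  have F0: "?F x = 0" using F[of x] by simp
  have "(?F has_derivative (\<lambda>v. 0)) (at x)"
    unfolding has_derivative_at
  proof (intro conjI)
    have le: "norm (norm (?F (x + h) - ?F x - 0) / norm h) \<le> M * norm h" for h
      using F[of "x + h"] F0 by (cases "h = 0") (auto simp: field_simps power2_eq_square)
    have "((\<lambda>h::real ^ 'n. M * norm h) \<longlongrightarrow> M * norm (0 :: real ^ 'n)) (at 0)"
      by (intro tendsto_intros)
    then have "((\<lambda>h::real ^ 'n. M * norm h) \<longlongrightarrow> 0) (at 0)" by simp
    then show "((\<lambda>h. norm (?F (x + h) - ?F x - 0) / norm h) \<longlongrightarrow> 0) (at 0)"
      by (rule Lim_null_comparison[OF always_eventually[OF allI[OF le]]])
  qed simp
  from has_derivative_add[OF this bounded_linear_imp_has_derivative[OF bounded_linear_vec_nth, of b]]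
  show ?thesis by (simp add: grad inner_axis')
qed

lemma emeasure_thin_slab:
  fixes a :: "'n::finite"
  shows "emeasure lborel ({x :: real ^ 'n. \<forall>i. -2 < x $ i \<and> x $ i < 2} \<inter> {x. 0 < x $ a \<and> x $ a < 1 / 2 ^ N})
    \<le> ennreal (4 ^ (CARD('n) - 1) * (1/2) ^ N)"
proof -
  let ?c = "(\<chi> i. if i = a then 0 else - 2) :: real ^ 'n" and ?d = "(\<chi> i. if i = a then 1 / 2 ^ N else 2) :: real ^ 'n"
  have "emeasure lborel ({x :: real ^ 'n. \<forall>i. -2 < x $ i \<and> x $ i < 2} \<inter> {x. 0 < x $ a \<and> x $ a < 1 / 2 ^ N})
      \<le> emeasure lborel (cbox ?c ?d)"
    by (intro emeasure_mono) (auto simp: mem_box_cart less_imp_le)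
  also have "\<dots> = ennreal (measure lborel (cbox ?c ?d))"
    by (intro emeasure_eq_ennreal_measure) (use emeasure_bounded_finite[of "cbox ?c ?d"] in auto)
  also have "measure lborel (cbox ?c ?d) = (\<Prod>i\<in>UNIV. ?d $ i - ?c $ i)"
    by (rule content_cbox_cart) (auto simp: interval_ne_empty_cart)
  also have "\<dots> = (1 / 2 ^ N) * (\<Prod>i\<in>UNIV - {a}. ?d $ i - ?c $ i)"
    by (subst prod.remove[of _ a]) auto
  also have "(\<Prod>i\<in>UNIV - {a}. ?d $ i - ?c $ i) = 4 ^ (CARD('n) - 1)"
    by (simp add: card_Diff_singleton)
  finally show ?thesis by (simp add: power_divide)
qed

lemma rippled_grad_measurable: "rippled_grad N a b \<in> borel_measurable borel"
proof (rule borel_measurable_continuous_onI)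
  have b: "continuous_on UNIV (\<lambda>x::real ^ 'a. bump (c * x $ i - 1))" "continuous_on UNIV (\<lambda>x::real ^ 'a. bump_deriv (c * x $ i - 1))" for c i
    by (rule continuous_on_compose2[OF continuous_on_bump(1)] continuous_on_compose2[OF continuous_on_bump(2)];
        auto intro!: continuous_intros)+
  show "continuous_on UNIV (rippled_grad N a b)"
    unfolding rippled_grad_def[abs_def] ripple_dy_def ripple_dz_def by (intro continuous_intros b)
qed

lemma rippled_lim_approximation:
  fixes a b :: "'n::finite"
  obtains K where "gradient_approximation {x :: real ^ 'n. \<forall>i. -2 < x $ i \<and> x $ i < 2} (\<lambda>N. rippled N a b)
    (rippled_lim a b) (\<lambda>N. rippled_grad N a b) (rippled_lim_grad a b) K (\<lambda>N. {x. 0 < x $ a \<and> x $ a < 1 / 2 ^ N})"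
proof -
  let ?\<Omega> = "{x :: real ^ 'n. \<forall>i. -2 < x $ i \<and> x $ i < 2}"
  let ?S = "\<lambda>N. {x :: real ^ 'n. 0 < x $ a \<and> x $ a < 1 / 2 ^ N}"
  obtain M where M: "0 \<le> M" "\<And>k y z. \<bar>ripple k y z\<bar> \<le> M / 4 ^ k"
    "\<And>k y z. \<bar>ripple_dy k y z\<bar> \<le> M" "\<And>k y z. \<bar>ripple_dz k y z\<bar> \<le> M"
    using ripple_bounded by metis
  \<comment> \<open>The gradients need 2 * M + 1, the values on the box 2 + M; \<open>K\<close>
    dominates both.\<close>
  define K where "K = 2 * M + 2"
  have box: "?\<Omega> = box (\<chi> i. -2) (\<chi> i. 2)" by (auto simp: mem_box_cart)
  have M1: "\<bar>ripple k y z\<bar> \<le> M" for k y z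
  proof -
    have "M / 4 ^ k \<le> M / 1" using M(1) by (intro divide_left_mono) auto
    then show ?thesis using M(2)[of k y z] by simp
  qed
  have grad: "norm (r *\<^sub>R axis a 1 + (1 + s) *\<^sub>R axis b (1::real)) \<le> K" if "\<bar>r\<bar> \<le> M" "\<bar>s\<bar> \<le> M" for r s
  proof -
    have "norm (r *\<^sub>R axis a (1::real) + (1 + s) *\<^sub>R axis b 1) \<le> \<bar>r\<bar> + \<bar>1 + s\<bar>"
      using norm_triangle_ineq[of "r *\<^sub>R axis a (1::real)" "(1 + s) *\<^sub>R axis b 1"] by (simp add: norm_axis_1)
    then show ?thesis using that by (simp add: K_def)
  qed
  have gN: "norm (rippled_grad N a b x) \<le> K" and gl: "norm (rippled_lim_grad a b x) \<le> K" for N and x :: "real ^ 'n"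
  proof -
    obtain k where k: "\<And>N. rippled_grad N a b x = (if k < N then ripple_dy k (x $ a) (x $ b) else 0) *\<^sub>R axis a 1 +
      (1 + (if k < N then ripple_dz k (x $ a) (x $ b) else 0)) *\<^sub>R axis b 1"
    "rippled_lim_grad a b x = ripple_dy k (x $ a) (x $ b) *\<^sub>R axis a 1 +
      (1 + ripple_dz k (x $ a) (x $ b)) *\<^sub>R axis b 1"
      by (rule rippled_single[of a b x], rule that; blast)
    show "norm (rippled_grad N a b x) \<le> K" "norm (rippled_lim_grad a b x) \<le> K"
      unfolding k by (rule grad; use M in simp)+
  qed
  have lim: "eventually (\<lambda>N. x \<notin> ?S N) sequentially" for x
  proof (cases "0 < x $ a")
    case True
    then obtain N where N: "(1/2) ^ N < x $ a"
      using real_arch_pow_inv[of "x $ a" "1/2"] by auto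
    have "x \<notin> ?S n" if "N \<le> n" for n
    proof -
      have "(1/2 :: real) ^ n \<le> (1/2) ^ N" using that by (intro power_decreasing) auto
      then show ?thesis using N by (auto simp: power_divide)
    qed
    then show ?thesis by (rule eventually_sequentiallyI)
  qed auto
  have Sm: "?S N \<in> sets borel" for N
    by (intro borel_open open_Collect_conj open_Collect_less continuous_intros)
  show thesis
  proof (rule that[of K], unfold_locales)
    show "open ?\<Omega>" "bounded ?\<Omega>" unfolding box by auto
    \<comment> \<open>Continuity may fail at \<open>x $ a = 0\<close>, so measurability is inherited
      from the continuous gradients of the partial sums.\<close>
    show "rippled_lim_grad a b \<in> borel_measurable borel"
    proof (rule borel_measurable_LIMSEQ_metric[OF rippled_grad_measurable])
      fix x :: "real ^ 'n"
      show "(\<lambda>N. rippled_grad N a b x) \<longlonglongrightarrow> rippled_lim_grad a b x"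
        by (rule tendsto_eventually) (use lim[of x] in \<open>eventually_elim, simp add: rippled_eq_lim(2)\<close>)
    qed
    show "(\<Sum>N. emeasure lborel (?\<Omega> \<inter> ?S N)) < \<infinity>"
    proof -
      have "(\<Sum>N. emeasure lborel (?\<Omega> \<inter> ?S N)) \<le> (\<Sum>N. ennreal (4 ^ (CARD('n) - 1) * (1/2) ^ N))"
        by (intro suminf_le emeasure_thin_slab) auto
      also have "\<dots> < \<infinity>"
      proof -
        have "summable (\<lambda>N. 4 ^ (CARD('n) - 1) * (1/2 :: real) ^ N)"
          by (intro summable_mult summable_geometric) simp
        then have "(\<Sum>N. ennreal (4 ^ (CARD('n) - 1) * (1/2) ^ N)) \<noteq> top"
          by (rule ennreal_suminf_neq_top) simp
        then show ?thesis by (simp only: less_top infinity_ennreal_def)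
      qed
      finally show ?thesis .
    qed
    show "rippled N a b x = rippled_lim a b x \<and> rippled_grad N a b x = rippled_lim_grad a b x"
      if "x \<notin> ?S N" for N x
      using that by (intro conjI rippled_eq_lim) auto
    show "\<bar>rippled N a b x\<bar> \<le> K" if "x \<in> ?\<Omega>" for N x
    proof -
      obtain k where "rippled N a b x = x $ b + (if k < N then ripple k (x $ a) (x $ b) else 0)"
        by (rule rippled_single[of a b x], rule that; blast)
      moreover have "\<bar>x $ b\<bar> \<le> 2" using that by (auto simp: abs_le_iff less_imp_le) (smt (verit))
      ultimately show ?thesis using M1[of k "x $ a" "x $ b"] M(1) by (auto simp: K_def split: if_splits)
    qed
  qed (use rippled_has_derivative rippled_lim_has_derivative rippled_grad_measurable gN gl Sm lim in auto)
qed

lemma rippled_uniform_limit: "uniform_limit A (\<lambda>N. rippled N a b) (rippled_lim a b) sequentially"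
proof (rule uniform_limitI)
  obtain M where M: "0 \<le> M" "\<And>k y z. \<bar>ripple k y z\<bar> \<le> M / 4 ^ k"
    using ripple_bounded by metis
  fix e :: real assume "0 < e"
  have "(\<lambda>N. M * (1/4) ^ N) \<longlonglongrightarrow> M * 0"
    by (intro tendsto_intros LIMSEQ_realpow_zero) auto
  then have "eventually (\<lambda>N. M * (1/4) ^ N < e) sequentially"
    using \<open>0 < e\<close> by (intro order_tendstoD(2)) auto
  then show "eventually (\<lambda>N. \<forall>x\<in>A. dist (rippled N a b x) (rippled_lim a b x) < e) sequentially"
  proof (eventually_elim, intro ballI)
    fix N x assume N: "M * (1/4) ^ N < e"
    obtain k where k: "\<And>N. rippled N a b x = x $ b + (if k < N then ripple k (x $ a) (x $ b) else 0)"
      "rippled_lim a b x = x $ b + ripple k (x $ a) (x $ b)"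
      by (rule rippled_single[of a b x], rule that; blast)
    show "dist (rippled N a b x) (rippled_lim a b x) < e"
    proof (cases "k < N")
      case False
      then have "(1/4 :: real) ^ k \<le> (1/4) ^ N" by (intro power_decreasing) auto
      then have "M * (1/4) ^ k \<le> M * (1/4) ^ N" using M(1) by (rule mult_left_mono)
      then show ?thesis using False M(2)[of k "x $ a" "x $ b"] N by (simp add: k dist_real_def power_divide)
    qed (use \<open>0 < e\<close> in \<open>simp add: k\<close>)
  qed
qed

lemma rippled_smooth: "smooth_on S (rippled N a b)"
  unfolding smooth_on_def
proof
  fix k
  have "Ck_on k UNIV (\<lambda>x::real ^ 'a. x $ b + (\<Sum>k<N. ripple k (x $ a) (x $ b)))"
  proof (rule Ck_on_add[OF open_UNIV Ck_on_linear[OF open_UNIV bounded_linear_vec_nth] Ck_on_sum[OF open_UNIV]])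
    show "Ck_on k UNIV (\<lambda>x::real ^ 'a. ripple j (x $ a) (x $ b))" for j
      using ripple_smooth[of UNIV j a b] by (simp add: smooth_on_def)
  qed
  then have "Ck_on k UNIV (rippled N a b)" by (simp add: rippled_def[abs_def])
  then show "Ck_on k S (rippled N a b)" by (rule Ck_on_subset) simp
qed

section \<open>Level sets\<close>

text \<open>Euclidean spaces are locally connected, so a chart at \<open>p\<close> would provide a
  connected relative neighbourhood of \<open>p\<close> in \<open>L\<close>, whatever its dimension.
  It contains every point of \<open>L\<close> close to \<open>p\<close>, among them some
  \<open>q\<close> that \<open>A\<close> and \<open>B\<close> separate from
  \<open>p\<close>.\<close>

lemma not_topological_manifoldI:
  fixes L :: "'a::metric_space set"
  assumes "p \<in> L"
    and sep: "\<And>\<delta>. \<delta> > 0 \<Longrightarrow> \<exists>q A B. q \<in> L \<and> dist p q < \<delta> \<and> open A \<and> open B \<and> A \<inter> B = {} \<and>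
      L \<subseteq> A \<union> B \<and> p \<in> A \<and> q \<in> B"
  shows "\<not> topological_manifold (top_of_set L)"
proof
  assume "topological_manifold (top_of_set L)"
  then obtain d W V where W: "openin (top_of_set L) W" "p \<in> W" and V: "openin (Euclidean_space d) V"
    and hom: "subtopology (top_of_set L) W homeomorphic_space subtopology (Euclidean_space d) V"
    using \<open>p \<in> L\<close> by (auto simp: topological_manifold_def topological_manifold_dim_def)
  have "locally_connected_space (subtopology (Euclidean_space d) V)"
    by (rule locally_connected_space_open_subset[OF locally_connected_Euclidean_space V])
  then have "locally_connected_space (subtopology (top_of_set L) W)"
    using homeomorphic_locally_connected_space[OF hom] by simp
  moreover have "subtopology (top_of_set L) W = top_of_set W"
    using openin_imp_subset[OF W(1)] by (simp add: subtopology_subtopology inf.absorb2)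
  ultimately have "locally_connected_space (top_of_set W)" by simp
  then obtain C where C: "openin (top_of_set W) C" "connected C" "p \<in> C"
    using W(2) unfolding locally_connected_space
    by (metis connectedin_subtopology connectedin_iff_connected openin_topspace topspace_euclidean_subtopology)
  obtain T where T: "open T" "C = L \<inter> T"
    using openin_trans[OF C(1) W(1)] by (auto simp: openin_open)
  obtain \<delta> where \<delta>: "\<delta> > 0" "ball p \<delta> \<subseteq> T"
    using T C(3) open_contains_ball by blast
  obtain q A B where q: "q \<in> L" "dist p q < \<delta>" "open A" "open B" "A \<inter> B = {}" "L \<subseteq> A \<union> B" "p \<in> A" "q \<in> B"
    using sep[OF \<delta>(1)] by blast
  have "q \<in> C" using q \<delta> T by auto
  have "A \<inter> C = {} \<or> B \<inter> C = {}"
    by (rule connectedD[OF C(2) q(3,4)]) (use q T in auto)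
  then show False using q(7,8) C(3) \<open>q \<in> C\<close> by blast
qed

section \<open>Countability of the critical values\<close>

lemma countable_sin_zeros:
  assumes "c \<noteq> 0"
  shows "countable {z::real. sin (c * z + d) = 0}"
proof -
  have "{z. sin (c * z + d) = 0} \<subseteq> range (\<lambda>i::int. (of_int i * pi - d) / c)"
  proof
    fix z assume "z \<in> {z. sin (c * z + d) = 0}"
    then obtain i :: int where "c * z + d = of_int i * pi"
      by (auto simp: sin_zero_iff_int2)
    then have "z = (of_int i * pi - d) / c" using assms by (simp add: field_simps)
    then show "z \<in> range (\<lambda>i::int. (of_int i * pi - d) / c)" by blast
  qed
  then show ?thesis by (rule countable_subset) simp
qed

lemma countable_cos_level:
  assumes "c \<noteq> 0" "\<bar>\<alpha>\<bar> \<le> 1"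
  shows "countable {z::real. cos (c * z) = \<alpha>}"
proof -
  let ?w = "arccos \<alpha>"
  have "{z. cos (c * z) = \<alpha>} \<subseteq> {z. sin (c / 2 * z + ?w / 2) = 0} \<union> {z. sin (c / 2 * z + - ?w / 2) = 0}"
  proof
    fix z assume "z \<in> {z. cos (c * z) = \<alpha>}"
    then have "cos ?w - cos (c * z) = 0" using assms(2) by (simp add: cos_arccos_abs)
    \<comment> \<open>The difference of the two cosines factors into two sines, which reduces the
      claim to zeros of sine.\<close>
    then have "sin ((?w + c * z) / 2) = 0 \<or> sin ((c * z - ?w) / 2) = 0"
      by (simp add: cos_diff_cos)
    then show "z \<in> {z. sin (c / 2 * z + ?w / 2) = 0} \<union> {z. sin (c / 2 * z + - ?w / 2) = 0}"
      by (auto simp: add_divide_distrib diff_divide_distrib add.commute)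
  qed
  then show ?thesis
    by (rule countable_subset) (intro countable_Un countable_sin_zeros; use assms in simp)
qed

text \<open>An explicit list of critical values replaces Sard's theorem. The \<open>y\<close>-slope
  of a ripple is a product, so at a critical point either the sine vanishes or \<open>bump\<close>
  is at its peak; each case leaves countably many heights.\<close>

lemma rippled_regular_values:
  fixes a b :: "'n::finite"
  assumes "a \<noteq> b"
  obtains C :: "real set" where "countable C"
    "\<And>N x. rippled N a b x \<notin> C \<Longrightarrow> \<exists>i. frechet_derivative (rippled N a b) (at x) (axis i 1) \<noteq> 0"
proof -
  \<comment> \<open>The first sets are heights where the ripple vanishes. The second are values on
    the centre line of a strip, where the slope 1 + 10 * cos(4^k z) is 0 exactly if the cosine is
    -1/10. The union over all \<open>k\<close> serves every \<open>N\<close>.\<close>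
  define C :: "real set" where "C = (\<Union>k. {z. sin (4 ^ k * z) = 0} \<union>
    (\<lambda>z. z + 10 / 4 ^ k * sin (4 ^ k * z)) ` {z. cos (4 ^ k * z) = - 1 / 10})"
  show thesis
  proof (rule that[of C])
    show "countable C"
      unfolding C_def
      using countable_sin_zeros[of "4 ^ _" 0] countable_cos_level[of "4 ^ _" "- 1 / 10"] by auto
  next
    fix N and x :: "real ^ 'n"
    assume C: "rippled N a b x \<notin> C"
    obtain k where k: "rippled N a b x = x $ b + (if k < N then ripple k (x $ a) (x $ b) else 0)"
      and g: "rippled_grad N a b x = (if k < N then ripple_dy k (x $ a) (x $ b) else 0) *\<^sub>R axis a 1 +
        (1 + (if k < N then ripple_dz k (x $ a) (x $ b) else 0)) *\<^sub>R axis b 1"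
      by (rule rippled_single[of a b x], rule that; blast)
    have D: "frechet_derivative (rippled N a b) (at x) (axis i 1) = rippled_grad N a b x $ i" for i
      by (simp add: inner_axis flip: frechet_derivative_at[OF rippled_has_derivative])
    have "rippled_grad N a b x $ a \<noteq> 0 \<or> rippled_grad N a b x $ b \<noteq> 0"
    proof (rule ccontr)
      assume "\<not> ?thesis"
      then have 0: "rippled_grad N a b x $ a = 0" "rippled_grad N a b x $ b = 0" by auto
      \<comment> \<open>Without an active ripple the \<open>b\<close>-component of the gradient is
        1. At a critical point the ripple must contribute slope -1, which also forces
        \<open>x $ a\<close> into the open strip.\<close>
      have kN: "k < N" using 0(2) assms by (auto simp: g axis_def split: if_splits)
      have dy: "ripple_dy k (x $ a) (x $ b) = 0" and dz: "ripple_dz k (x $ a) (x $ b) = - 1"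
        using 0 kN assms by (auto simp: g axis_def)
      let ?w = "2 ^ Suc k * x $ a - 1"
      have w: "0 < ?w" "?w < 1"
      proof -
        have "bump ?w \<noteq> 0" using dz by (auto simp: ripple_dz_def)
        then have "?w \<in> {0<..<1}" using bump_outside[of ?w] by blast
        then show "0 < ?w" "?w < 1" by (simp_all only: greaterThanLessThan_iff)
      qed
      from dy have "bump_deriv ?w = 0 \<or> sin (4 ^ k * x $ b) = 0" by (simp add: ripple_dy_def)
      then show False
      proof
        assume "sin (4 ^ k * x $ b) = 0"
        then have "rippled N a b x \<in> C" by (auto simp: k ripple_def C_def)
        then show False using C by simp
      next
        assume "bump_deriv ?w = 0"
        then have "?w = 1/2" using w by (intro bump_deriv_eq_0)
        then have b: "bump ?w = 1" using bump_half by metis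
        then have "cos (4 ^ k * x $ b) = - 1 / 10" using dz by (simp add: ripple_dz_def)
        moreover have "rippled N a b x = x $ b + 10 / 4 ^ k * sin (4 ^ k * x $ b)"
          using kN b by (simp add: k ripple_def)
        ultimately have "rippled N a b x \<in> C" unfolding C_def by blast
        then show False using C by simp
      qed
    qed
    then show "\<exists>i. frechet_derivative (rippled N a b) (at x) (axis i 1) \<noteq> 0"
      unfolding D by blast
  qed
qed

text \<open>The edges are included because the formula will be evaluated on the boundary of a
  rectangle; no other open strip reaches them.\<close>

lemma rippled_lim_closed_strip:
  assumes "1 \<le> 2 ^ Suc k * x $ a" "2 ^ Suc k * x $ a \<le> 2"
  shows "rippled_lim a b x = x $ b + ripple k (x $ a) (x $ b)"
proof -
  have pos: "0 < x $ a"
  proof -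
    have "0 < 2 ^ Suc k * x $ a" using assms(1) by linarith
    then show ?thesis by (rule zero_less_mult_pos) simp
  qed
  have "x $ a \<notin> strip j" if "j \<noteq> k" for j
  proof (cases "j < k")
    case True
    then show ?thesis using strip_less[of "x $ a" j k] assms(2) by auto
  next
    case False
    have "2 * (2 ^ Suc k * x $ a) = 2 ^ Suc (Suc k) * x $ a" by simp
    also have "\<dots> \<le> 2 ^ Suc j * x $ a"
      using False that pos by (intro mult_right_mono power_increasing) auto
    finally have "2 \<le> 2 ^ Suc j * x $ a" using assms(1) by linarith
    then show ?thesis by (simp add: strip_def)
  qed
  then have "ripple j (x $ a) (x $ b) = 0" if "j \<noteq> k" for j
    using that ripple_outside by blast
  then show ?thesis
    unfolding rippled_lim_def by (subst sum_single_strip(2)[of k]) auto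
qed

text \<open>At every height \<open>t\<close> and every scale \<open>k\<close> a rectangle of size \<open>2^-k\<close> separates the level set: on its
  boundary the ripple vanishes and \<open>rippled_lim\<close> is less than \<open>t\<close>, while the ripple reaches above \<open>t\<close>
  inside. These rectangles accumulate at the point of height \<open>t\<close> on the axis.\<close>

lemma rippled_lim_level_island:
  fixes a b :: "'n::finite" and t :: real
  assumes "a \<noteq> b"
  defines "L \<equiv> {x. rippled_lim a b x = t}" and "p \<equiv> t *\<^sub>R axis b 1"
  obtains q A B where "rippled_lim a b q = t" "dist p q \<le> 11 * (1/2) ^ k" "open A" "open B" "A \<inter> B = {}"
    "L \<subseteq> A \<union> B" "p \<in> A" "q \<in> B"
proof -
  \<comment> \<open>The integer \<open>n\<close> places the rescaled height 4^k * t in the interval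
    from l + pi (excluded) to l + 3 * pi: above the top edge of the rectangle, yet within reach of
    the ripple.\<close>
  define r where "r = 4 ^ k * t / pi"
  define n where "n = \<lceil>(r - 3) / 2\<rceil>"
  define l where "l = 2 * pi * of_int n"
  have "of_int n - 1 < (r - 3) / 2" "(r - 3) / 2 \<le> of_int n"
    using ceiling_correct[of "(r - 3) / 2"] by (simp_all only: n_def)
  then have "r \<le> 2 * of_int n + 3" "2 * of_int n + 1 < r"
    by (simp_all add: field_simps)
  then have "r * pi \<le> (2 * of_int n + 3) * pi" "(2 * of_int n + 1) * pi < r * pi"
    by (auto intro: mult_right_mono)
  then have l: "4 ^ k * t \<le> l + 3 * pi" "l + pi < 4 ^ k * t"
    by (simp_all add: l_def r_def algebra_simps)
  have sl: "sin l = 0" "cos l = 1" by (simp_all add: l_def sin_int_2pin cos_int_2pin)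
  \<comment> \<open>On the centre line the rescaled function is s + 10 * sin s. It equals
    \<open>l\<close> at \<open>l\<close>, and at l + pi/2 it is at least l + 3 * pi since 5 * pi / 2
    \<le> 10: here the amplitude 10 is large enough.\<close>
  have "\<exists>s. l \<le> s \<and> s \<le> l + pi / 2 \<and> s + 10 * sin s = 4 ^ k * t"
  proof (rule IVT)
    show "l + 10 * sin l \<le> 4 ^ k * t" using l(2) sl pi_gt_zero by linarith
    have "sin (l + pi / 2) = 1" by (simp add: sin_add sl)
    then show "4 ^ k * t \<le> l + pi / 2 + 10 * sin (l + pi / 2)" using l(1) pi_less_4 by simp
  qed (auto intro!: continuous_intros)
  then obtain s where s: "l \<le> s" "s \<le> l + pi / 2" "s + 10 * sin s = 4 ^ k * t" by blast
  have "s \<noteq> l" using s(3) l(2) sl pi_gt_zero by auto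
  with s have s': "l < s" "s < l + pi" using pi_gt_zero by auto
  \<comment> \<open>The first coefficient is the centre of the strip, where \<open>bump\<close> is
    1.\<close>
  define q :: "real ^ 'n" where "q = (3 / 4 * (1/2) ^ k) *\<^sub>R axis a 1 + (s / 4 ^ k) *\<^sub>R axis b 1"
  have q: "q $ a = 3 / 4 * (1/2) ^ k" "q $ b = s / 4 ^ k"
    using assms(1) by (auto simp: q_def axis_def)
  have qa: "2 ^ Suc k * q $ a = 3 / 2" by (simp add: q power_divide)
  define B :: "(real ^ 'n) set" where "B = {x. 1 < 2 ^ Suc k * x $ a \<and> 2 ^ Suc k * x $ a < 2 \<and> l < 4 ^ k * x $ b \<and> 4 ^ k * x $ b < l + pi}"
  define Bc :: "(real ^ 'n) set" where "Bc = {x. 1 \<le> 2 ^ Suc k * x $ a \<and> 2 ^ Suc k * x $ a \<le> 2 \<and> l \<le> 4 ^ k * x $ b \<and> 4 ^ k * x $ b \<le> l + pi}"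
  show thesis
  proof (rule that)
    have "rippled_lim a b q = q $ b + ripple k (q $ a) (q $ b)"
      by (rule rippled_lim_closed_strip) (use qa in linarith)+
    also have "ripple k (q $ a) (q $ b) = 10 / 4 ^ k * sin s"
      unfolding ripple_def qa using bump_half by (simp add: q)
    also have "q $ b + 10 / 4 ^ k * sin s = (s + 10 * sin s) / 4 ^ k"
      by (simp add: q add_divide_distrib)
    also have "\<dots> = t" by (simp add: s(3))
    finally show "rippled_lim a b q = t" .
    \<comment> \<open>The vertical offset between \<open>p\<close> and \<open>q\<close> is exactly
      the height of the ripple at \<open>q\<close>, so it is at most 10 / 4^k; with the horizontal
      offset the total stays below 11 / 2^k.\<close>
    have tz: "t - s / 4 ^ k = 10 * sin s / 4 ^ k" using s(3) by (simp add: field_simps)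
    have "dist p q = norm ((t - s / 4 ^ k) *\<^sub>R axis b 1 - (3 / 4 * (1/2) ^ k) *\<^sub>R axis a (1::real))"
      by (simp add: p_def q_def dist_norm algebra_simps)
    also have "\<dots> \<le> \<bar>10 * sin s / 4 ^ k\<bar> + 3 / 4 * (1/2) ^ k"
      by (rule order_trans[OF norm_triangle_ineq4]) (simp add: norm_axis_1 tz)
    also have "\<bar>10 * sin s / 4 ^ k\<bar> \<le> 10 * (1/2) ^ k"
    proof -
      have "\<bar>10 * sin s / 4 ^ k\<bar> = 10 * \<bar>sin s\<bar> / 4 ^ k" by (simp add: abs_mult)
      also have "\<dots> \<le> 10 * 1 / 4 ^ k" by (intro divide_right_mono mult_left_mono) auto
      also have "\<dots> \<le> 10 * 1 / 2 ^ k" by (intro divide_left_mono power_mono) auto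
      finally show ?thesis by (simp add: power_divide)
    qed
    finally show "dist p q \<le> 11 * (1/2) ^ k"
      using zero_le_power[of "1/2 :: real" k] by linarith
    have "closed Bc"
      unfolding Bc_def by (intro closed_Collect_conj closed_Collect_le continuous_intros)
    then show "open (- Bc)" by (rule open_Compl)
    show "open B"
      unfolding B_def by (intro open_Collect_conj open_Collect_less continuous_intros)
    show "- Bc \<inter> B = {}" by (auto simp: B_def Bc_def)
    show "q \<in> B" using s' by (simp only: B_def mem_Collect_eq qa) (simp add: q)
    have "p $ a = 0" using assms(1) by (simp add: p_def axis_def)
    then show "p \<in> - Bc" by (simp add: Bc_def)
    show "L \<subseteq> - Bc \<union> B"
    proof
      fix x assume "x \<in> L"
      show "x \<in> - Bc \<union> B"
      proof (rule ccontr)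
        assume "x \<notin> - Bc \<union> B"
        then have x: "x \<in> Bc" "x \<notin> B" by auto
        have "rippled_lim a b x = x $ b + ripple k (x $ a) (x $ b)"
          using x(1) by (intro rippled_lim_closed_strip) (auto simp: Bc_def)
        \<comment> \<open>Two edges lie where \<open>bump\<close> vanishes, the other two where the
          sine does. Then \<open>x $ b\<close> would equal \<open>t\<close>, although it is at most
          (l + pi) / 4^k.\<close>
        moreover have "ripple k (x $ a) (x $ b) = 0"
        proof (cases "x $ a \<in> strip k")
          case True
          then have "4 ^ k * x $ b = l \<or> 4 ^ k * x $ b = l + pi"
            using x by (auto simp: B_def Bc_def strip_def)
          then have "sin (4 ^ k * x $ b) = 0" using sl by (auto simp: sin_add)
          then show ?thesis by (simp add: ripple_def)
        qed (simp add: ripple_outside)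
        ultimately have "x $ b = t" using \<open>x \<in> L\<close> by (simp add: L_def)
        then show False using x(1) l(2) by (simp add: Bc_def)
      qed
    qed
  qed
qed

lemma rippled_lim_level_not_manifold:
  fixes a b :: "'n::finite"
  assumes "a \<noteq> b" "-1 < t" "t < 1"
  shows "\<not> topological_manifold (top_of_set
    {x \<in> {x :: real ^ 'n. \<forall>i. -2 < x $ i \<and> x $ i < 2}. rippled_lim a b x = t})"
proof -
  let ?L = "{x \<in> {x :: real ^ 'n. \<forall>i. -2 < x $ i \<and> x $ i < 2}. rippled_lim a b x = t}"
  define p :: "real ^ 'n" where "p = t *\<^sub>R axis b 1"
  have p: "p $ a = 0" "p $ b = t" "\<bar>p $ i\<bar> < 1" for i
    using assms by (auto simp: axis_def p_def)
  have "rippled_lim a b p = t"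
    using rippled_eq_lim(1)[of p a 0 b] p by (simp add: rippled_def)
  moreover have "- 2 < p $ i \<and> p $ i < 2" for i using p(3)[of i] by linarith
  ultimately have pL: "p \<in> ?L" by blast
  show ?thesis
  proof (rule not_topological_manifoldI[OF pL])
    fix \<delta> :: real assume "\<delta> > 0"
    \<comment> \<open>Bounding the distance by 1 as well keeps \<open>q\<close> in the box, because
      all coordinates of \<open>p\<close> have absolute value below 1.\<close>
    then obtain k where "(1/2 :: real) ^ k < min \<delta> 1 / 11"
      using real_arch_pow_inv[of "min \<delta> 1 / 11" "1/2"] by auto
    then have k: "11 * (1/2) ^ k < \<delta>" "11 * (1/2 :: real) ^ k < 1" by auto
    obtain q A B where q: "rippled_lim a b q = t" "dist p q \<le> 11 * (1/2) ^ k" "open A" "open B" "A \<inter> B = {}"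
      "{x. rippled_lim a b x = t} \<subseteq> A \<union> B" "p \<in> A" "q \<in> B"
      by (rule rippled_lim_level_island[OF assms(1), of t k, folded p_def], rule that, assumption+)
    have "\<bar>p $ i - q $ i\<bar> < 1" for i
      using component_le_norm_cart[of "p - q" i] q(2) k(2) by (simp add: dist_norm)
    then have "- 2 < q $ i \<and> q $ i < 2" for i using p(3)[of i] by (smt (verit))
    then have "q \<in> ?L" using q(1) by simp
    then show "\<exists>q A B. q \<in> ?L \<and> dist p q < \<delta> \<and> open A \<and> open B \<and> A \<inter> B = {} \<and> ?L \<subseteq> A \<union> B \<and> p \<in> A \<and> q \<in> B"
      using q k(1) by (intro exI[of _ q] exI[of _ A] exI[of _ B]) auto
  qed
qed

theorem corollary12p2:
  fixes \<Omega> :: "(real ^ 'n::finite) set"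
  assumes "CARD('n) \<ge> 3"
    and "\<Omega> = {x. \<forall>i. -2 < x $ i \<and> x $ i < 2}"
  shows "\<exists>(Us :: nat \<Rightarrow> real ^ 'n \<Rightarrow> real) (U :: real ^ 'n \<Rightarrow> real).
    (\<forall>N. smooth_on \<Omega> (Us N) \<and> lebesgue_monotone \<Omega> (Us N)) \<and>
    (\<exists>L. L-lipschitz_on \<Omega> U) \<and> lebesgue_monotone \<Omega> U \<and>
    uniform_limit \<Omega> Us U sequentially \<and>
    (\<forall>p::real. 1 \<le> p \<longrightarrow> W1p_tendsto p \<Omega> Us U) \<and>
    (AE t in lebesgue. t \<in> {-1<..<1::real} \<longrightarrow>
       (\<forall>N. smooth_embedded_hypersurface {x \<in> \<Omega>. Us N x = t}) \<and>
       \<not> topological_manifold (top_of_set {x \<in> \<Omega>. U x = t})) \<and>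
    (\<exists>r :: nat \<Rightarrow> nat. strict_mono r \<and>
       (AE t in lebesgue. t \<in> {-1<..<1::real} \<longrightarrow>
          strict_BV_tendsto \<Omega> (\<lambda>N. indicator {x \<in> \<Omega>. Us (r N) x > t})
            (indicator {x \<in> \<Omega>. U x > t})))"
proof -
  \<comment> \<open>\<open>a\<close> and \<open>b\<close> index the coordinates \<open>y\<close> and
    \<open>z\<close>; neither the partial sums nor the limit depend on the coordinate
    \<open>c\<close>, which gives monotonicity.\<close>
  obtain T :: "'n set" where "card T = 3"
    using obtain_subset_with_card_n[OF assms(1)] by metis
  then obtain a b c :: 'n where abc: "a \<noteq> b" "a \<noteq> c" "b \<noteq> c" by (auto simp: card_3_iff)
  obtain K where K: "gradient_approximation \<Omega> (\<lambda>N. rippled N a b) (rippled_lim a b)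
      (\<lambda>N. rippled_grad N a b) (rippled_lim_grad a b) K (\<lambda>N. {x. 0 < x $ a \<and> x $ a < 1 / 2 ^ N})"
    by (rule rippled_lim_approximation[of a b, folded assms(2)], rule that, assumption)
  interpret gradient_approximation \<Omega> "\<lambda>N. rippled N a b" "rippled_lim a b"
    "\<lambda>N. rippled_grad N a b" "rippled_lim_grad a b" K "\<lambda>N. {x. 0 < x $ a \<and> x $ a < 1 / 2 ^ N}"
    by (rule K)
  have "\<Omega> = box (\<chi> i. -2) (\<chi> i. 2)" by (auto simp: mem_box_cart assms(2))
  then have "convex \<Omega>" by simp
  have inv: "(x + s *\<^sub>R axis c 1) $ a = x $ a" "(x + s *\<^sub>R axis c 1) $ b = x $ b" for x :: "real ^ 'n" and s
    using abc by (auto simp: axis_def)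
  have cont: "continuous_on \<Omega> (rippled N a b)" "continuous_on \<Omega> (rippled_lim a b)" for N
    using us u by (auto intro!: has_derivative_continuous_on intro: has_derivative_at_withinI)
  have mono: "lebesgue_monotone \<Omega> (rippled N a b)" "lebesgue_monotone \<Omega> (rippled_lim a b)" for N
  proof -
    have "axis c 1 \<noteq> (0 :: real ^ 'n)" by (simp add: axis_eq_0_iff)
    note m = lebesgue_monotone_if_invariant[OF _ this]
    show "lebesgue_monotone \<Omega> (rippled N a b)"
      by (rule m[OF cont(1)]) (simp only: rippled_def inv)
    show "lebesgue_monotone \<Omega> (rippled_lim a b)"
      by (rule m[OF cont(2)]) (simp only: rippled_lim_def inv)
  qed
  obtain C :: "real set" where C: "countable C"
    "\<And>N x. rippled N a b x \<notin> C \<Longrightarrow> \<exists>i. frechet_derivative (rippled N a b) (at x) (axis i 1) \<noteq> 0"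
    by (rule rippled_regular_values[OF abc(1)], rule that, assumption, blast)
  \<comment> \<open>Only the smoothness of the level sets of the partial sums requires avoiding a
    null set; the limit fails at every height in the interval.\<close>
  have "AE t in lborel. t \<notin> C"
    by (intro AE_not_in countable_imp_null_set_lborel C(1))
  then have level: "AE t in lebesgue. t \<in> {-1<..<1::real} \<longrightarrow>
       (\<forall>N. smooth_embedded_hypersurface {x \<in> \<Omega>. rippled N a b x = t}) \<and>
       \<not> topological_manifold (top_of_set {x \<in> \<Omega>. rippled_lim a b x = t})"
  proof (intro AE_completion, eventually_elim, intro impI conjI allI)
    fix t :: real and N assume t: "t \<notin> C"
    show "smooth_embedded_hypersurface {x \<in> \<Omega>. rippled N a b x = t}"
      by (rule smooth_embedded_hypersurface_level_set[OF \<Omega>(1) rippled_smooth]) (use C(2) t in blast)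
  next
    fix t :: real assume "t \<in> {-1<..<1}"
    then show "\<not> topological_manifold (top_of_set {x \<in> \<Omega>. rippled_lim a b x = t})"
      unfolding assms(2) by (intro rippled_lim_level_not_manifold abc(1)) auto
  qed
  \<comment> \<open>The comparison constant -1 lies below all heights considered. Writing
    \<open>id N\<close> fits the statement to the existential over subsequences.\<close>
  have BV: "AE t in lebesgue. t \<in> {-1<..<1::real} \<longrightarrow>
      strict_BV_tendsto \<Omega> (\<lambda>N. indicator {x \<in> \<Omega>. rippled (id N) a b x > t}) (indicator {x \<in> \<Omega>. rippled_lim a b x > t})"
    using strict_BV_tendsto_superlevel[of "-1"] by eventually_elim auto
  show ?thesis
  proof (rule exI[of _ "\<lambda>N. rippled N a b"], rule exI[of _ "rippled_lim a b"], intro conjI allI impI)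
    show "\<exists>L. L-lipschitz_on \<Omega> (rippled_lim a b)"
      using lipschitz_on_limit[OF \<open>convex \<Omega>\<close>] by blast
    show "\<exists>r :: nat \<Rightarrow> nat. strict_mono r \<and> (AE t in lebesgue. t \<in> {-1<..<1::real} \<longrightarrow>
      strict_BV_tendsto \<Omega> (\<lambda>N. indicator {x \<in> \<Omega>. rippled (r N) a b x > t}) (indicator {x \<in> \<Omega>. rippled_lim a b x > t}))"
      using BV strict_mono_id by blast
  qed (rule rippled_smooth mono rippled_uniform_limit W1p_tendsto level | assumption)+
qed

end
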